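(* Hex-splines are not refinable: for the tessellation $T$ of $\mathbb{R}^2$ by regular hexagons and every order $k\ge 1$, there is no scaled-down copy $T^1$ of $T$ such that every hex-spline of order $k$ on $T$ is a linear combination of hex-splines of order $k$ on $T^1$.
   Context: Let $T$ be the regular tessellation of the plane by congruent regular hexagons, let $H$ be the indicator function ($1$ on the hexagon, $0$ elsewhere) of the hexagon of $T$ translated so as to be centered at the origin, and let $H^{*k}$ be the $k$-fold convolution $H*\cdots*H$ (with $H^{*1}=H$). The hex-splines of order $k$ on $T$ are the functions $x\mapsto H^{*k}(x-p)$, where $p$ ranges over the centers of the hexagons of $T$. A scaled-down copy of $T$ is a tessellation $T^1=\lambda T+v$ with $0<\lambda<1$, $v\in\mathbb{R}^2$ (for example $\tfrac12T$), and the hex-splines of order $k$ on $T^1$ are defined in the same way from the hexagons of $T^1$. Linear combinations may be infinite (the sums are locally finite); equality for $k=1$ is meant up to values on cell boundaries. *)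

theory Defs
  imports "HOL-Analysis.Analysis"
begin

definition polar :: "real \<Rightarrow> real \<Rightarrow> real ^ 2" where
  "polar r t = vector [r * cos t, r * sin t]"

text \<open>The closed regular hexagon with centre \<open>p\<close> and side length (circumradius) \<open>r\<close>, one of
  whose vertices lies in direction \<open>t\<close> from the centre.\<close>

definition hexagon :: "real \<Rightarrow> real \<Rightarrow> real ^ 2 \<Rightarrow> (real ^ 2) set" where
  "hexagon r t p = convex hull {p + polar r (t + real j * pi / 3) | j :: nat. j < 6}"

text \<open>The centres of adjacent hexagons lie at distance \<open>r * sqrt 3\<close> (twice the apothem), in the
  directions of the edge normals, which are the vertex directions turned by \<open>pi / 6\<close>. Two of these
  displacements at angle \<open>pi / 3\<close> generate the lattice of all centres. Size, orientation and
  position of the tessellation are arbitrary.\<close>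

definition hex_tessellation :: "(real ^ 2) set set \<Rightarrow> bool" where
  "hex_tessellation T \<longleftrightarrow> (\<exists>r t q. r > 0 \<and>
     T = {hexagon r t (q + of_int m *\<^sub>R polar (r * sqrt 3) (t + pi / 6)
                         + of_int n *\<^sub>R polar (r * sqrt 3) (t + pi / 2)) | m n :: int. True})"

definition scaled_copy :: "real \<Rightarrow> real ^ 2 \<Rightarrow> (real ^ 2) set set \<Rightarrow> (real ^ 2) set set" where
  "scaled_copy l v T = (\<lambda>C. (\<lambda>x. l *\<^sub>R x + v) ` C) ` T"

text \<open>The centre of a cell is its centre of symmetry, which is unique for a nonempty bounded set.\<close>

definition cell_center :: "(real ^ 2) set \<Rightarrow> real ^ 2" where
  "cell_center C = (THE p. (\<lambda>x. 2 *\<^sub>R p - x) ` C = C)"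

definition convolution :: "(real ^ 2 \<Rightarrow> real) \<Rightarrow> (real ^ 2 \<Rightarrow> real) \<Rightarrow> real ^ 2 \<Rightarrow> real" where
  "convolution f g x = (LINT y|lborel. f y * g (x - y))"

text \<open>The \<open>k\<close>-fold convolution of \<open>f\<close> with itself, meaningful for \<open>k \<ge> 1\<close> only; the first
  convolution power is \<open>f\<close>.\<close>

definition conv_power :: "(real ^ 2 \<Rightarrow> real) \<Rightarrow> nat \<Rightarrow> real ^ 2 \<Rightarrow> real" where
  "conv_power f k = (convolution f ^^ (k - 1)) f"

text \<open>The hex-spline of order \<open>k\<close> attached to the cell \<open>C\<close>: all cells of a tessellation have the
  same translate centred at the origin, so the hex-splines on \<open>T\<close> are indexed by the cells of \<open>T\<close>.\<close>

definition hex_spline :: "nat \<Rightarrow> (real ^ 2) set \<Rightarrow> real ^ 2 \<Rightarrow> real" where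
  "hex_spline k C x =
     conv_power (indicator ((\<lambda>y. y - cell_center C) ` C)) k (x - cell_center C)"

definition cell_boundaries :: "(real ^ 2) set set \<Rightarrow> (real ^ 2) set" where
  "cell_boundaries T = (\<Union>C\<in>T. frontier C)"

text \<open>Linear combinations may be infinite. At each point only finitely many terms are nonzero, so
  the sum below is in effect a finite one. For \<open>k = 1\<close> the values on cell boundaries, which depend
  on the hexagons being taken closed, are disregarded.\<close>

definition refinable_on :: "nat \<Rightarrow> (real ^ 2) set set \<Rightarrow> (real ^ 2) set set \<Rightarrow> bool" where
  "refinable_on k T T1 \<longleftrightarrow>
     (\<forall>C\<in>T. \<exists>a :: (real ^ 2) set \<Rightarrow> real.
        \<forall>x. (k = 1 \<longrightarrow> x \<notin> cell_boundaries T \<union> cell_boundaries T1) \<longrightarrow>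
          ((\<lambda>D. a D * hex_spline k D x) has_sum hex_spline k C x) T1)"

lemma center_of_symmetry_unique:
  fixes C :: "(real ^ 2) set"
  assumes "bounded C" "C \<noteq> {}"
    and p: "(\<lambda>x. 2 *\<^sub>R p - x) ` C = C" and q: "(\<lambda>x. 2 *\<^sub>R q - x) ` C = C"
  shows "p = q"
proof (rule ccontr)
  assume "p \<noteq> q"
  define d where "d = 2 *\<^sub>R (p - q)"
  have d0: "norm d > 0" using \<open>p \<noteq> q\<close> by (simp add: d_def)
  obtain x where x: "x \<in> C" using assms(2) by blast
  have step: "y + d \<in> C" if "y \<in> C" for y
  proof -
    have "2 *\<^sub>R q - y \<in> C" using q that by blast
    then have "2 *\<^sub>R p - (2 *\<^sub>R q - y) \<in> C" using p by blast
    then show ?thesis by (simp add: d_def algebra_simps)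
  qed
  have mem: "x + real n *\<^sub>R d \<in> C" for n
  proof (induction n)
    case 0
    then show ?case using x by simp
  next
    case (Suc n)
    then show ?case using step[OF Suc.IH] by (simp add: algebra_simps)
  qed
  obtain B where B: "\<And>y. y \<in> C \<Longrightarrow> norm y \<le> B" using assms(1) by (auto simp: bounded_iff)
  obtain n :: nat where n: "real n * norm d > 2 * B" using reals_Archimedean3[OF d0] by blast
  have "real n * norm d = norm ((x + real n *\<^sub>R d) - x)" by simp
  also have "\<dots> \<le> norm (x + real n *\<^sub>R d) + norm x" by (rule norm_triangle_ineq4)
  also have "\<dots> \<le> 2 * B" using B[OF mem[of n]] B[OF x] by linarith
  finally show False using n by simp
qed

lemma cell_center_hexagon: "cell_center (hexagon r t p) = p"
proof -
  define V where "V = {p + polar r (t + real j * pi / 3) | j :: nat. j < 6}"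
  have V_eq: "V = (\<lambda>j. p + polar r (t + real j * pi / 3)) ` {..<6}" by (auto simp: V_def)
  have anti: "polar r (s + pi) = - polar r s" and per: "polar r (s + 2 * pi) = polar r s" for s
    by (simp_all add: polar_def vec_eq_iff forall_2)
  have refl_V: "2 *\<^sub>R p - y \<in> V" if "y \<in> V" for y
  proof -
    obtain j :: nat where j: "j < 6" "y = p + polar r (t + real j * pi / 3)"
      using \<open>y \<in> V\<close> by (auto simp: V_def)
    have eq: "2 *\<^sub>R p - y = p + polar r (t + real j * pi / 3 + pi)"
      by (simp add: j anti scaleR_2)
    show ?thesis
    proof (cases "j < 3")
      case True
      have "t + real j * pi / 3 + pi = t + real (j + 3) * pi / 3" by (simp add: field_simps)
      then have "2 *\<^sub>R p - y = p + polar r (t + real (j + 3) * pi / 3)"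
        using eq by metis
      moreover have "j + 3 < 6" using True by simp
      ultimately show ?thesis unfolding V_def by blast
    next
      case False
      have "t + real j * pi / 3 + pi = (t + real (j - 3) * pi / 3) + 2 * pi"
        using False by (simp add: of_nat_diff field_simps)
      then have "2 *\<^sub>R p - y = p + polar r (t + real (j - 3) * pi / 3)"
        using eq per by metis
      moreover have "j - 3 < 6" using j by simp
      ultimately show ?thesis unfolding V_def by blast
    qed
  qed
  have img: "(\<lambda>x. 2 *\<^sub>R p - x) ` V = V"
  proof
    show "(\<lambda>x. 2 *\<^sub>R p - x) ` V \<subseteq> V" using refl_V by blast
    show "V \<subseteq> (\<lambda>x. 2 *\<^sub>R p - x) ` V"
    proof
      fix y assume "y \<in> V"
      then show "y \<in> (\<lambda>x. 2 *\<^sub>R p - x) ` V"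
        using refl_V by (intro image_eqI[of _ _ "2 *\<^sub>R p - y"]) auto
    qed
  qed
  have hull: "(\<lambda>x. 2 *\<^sub>R p - x) ` (convex hull V) = convex hull V"
  proof -
    have "(\<lambda>x. 2 *\<^sub>R p - x) ` S = (\<lambda>x. 2 *\<^sub>R p + x) ` (uminus ` S)" for S :: "(real ^ 2) set"
      by (simp add: image_image)
    moreover have "uminus ` (convex hull V) = convex hull (uminus ` V)"
      by (rule convex_hull_linear_image) (simp add: linear_iff)
    ultimately show ?thesis
      using img convex_hull_translation[of "2 *\<^sub>R p" "uminus ` V"] by metis
  qed
  have bd: "bounded (convex hull V)"
    by (intro bounded_convex_hull finite_imp_bounded) (simp add: V_eq)
  have ne: "convex hull V \<noteq> {}" by (simp add: V_eq lessThan_empty_iff)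
  show ?thesis
    unfolding cell_center_def hexagon_def V_def[symmetric]
    by (rule the_equality[where P = "\<lambda>p. (\<lambda>x. 2 *\<^sub>R p - x) ` (convex hull V) = convex hull V",
          OF hull center_of_symmetry_unique[OF bd ne _ hull]])
qed

end

(* Write H for the indicator of the hexagon centred at the origin. Off finitely many lines, H is a signed
   sum of translates of two cones to the vertices of the hexagon, and the product of the three difference
   operators with small steps along the edge directions turns each cone into something supported near its apex.
   Integrating a refinement relation against the k-fold such difference of a test function that is
   exp (q . x) near a point x0 and 0 elsewhere therefore evaluates an identity between k-fold compositions of
   discrete vertex operators at x0, and it only involves finitely many coefficients. As the weight is constant
   along the edge direction a, the vertices a and -a do not contribute, and the vertex operator
   factors as (1 - shift by a) composed with an operator transversal to a. On the top line of the coarse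
   hex-spline this leaves a relation in one variable: the k-th difference with step l a of a coefficient sequence
   has its last nonzero value at one point and vanishes at the point before it, because the next knot of the coarse
   spline is a distance 1 > l away. But the centres of the fine cells meet such a line in every third point only,
   and a sequence supported on one residue class modulo 3 cannot have such a difference. *)

theory Submission
  imports Defs "HOL-Computational_Algebra.Polynomial"
begin

section \<open>Correlation with bounded functions of bounded support\<close>

definition test_fun :: "('a::euclidean_space \<Rightarrow> real) \<Rightarrow> bool" where
  "test_fun f \<longleftrightarrow> f \<in> borel_measurable borel \<and> (\<exists>B. \<forall>x. \<bar>f x\<bar> \<le> B) \<and> (\<exists>R. \<forall>x. norm x > R \<longrightarrow> f x = 0)"

lemma test_funI:
  assumes "f \<in> borel_measurable borel" "\<And>x. \<bar>f x\<bar> \<le> B" "\<And>x. norm x > R \<Longrightarrow> f x = 0"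
  shows "test_fun f"
  using assms unfolding test_fun_def by blast

lemma test_fun_measurable: "test_fun f \<Longrightarrow> f \<in> borel_measurable borel"
  by (simp add: test_fun_def)

lemma test_funE:
  assumes "test_fun f"
  obtains B R where "B \<ge> 0" "R \<ge> 0" "\<And>x. \<bar>f x\<bar> \<le> B" "\<And>x. norm x > R \<Longrightarrow> f x = 0"
proof -
  obtain B R where "\<And>x. \<bar>f x\<bar> \<le> B" "\<And>x. norm x > R \<Longrightarrow> f x = 0"
    using assms unfolding test_fun_def by blast
  then show thesis
    by (intro that[of "max B 0" "max R 0"]) (auto simp: le_max_iff_disj)
qed

lemma test_fun_integrable:
  assumes "test_fun f" shows "integrable lborel f"
proof -
  obtain B R where BR: "\<And>x. \<bar>f x\<bar> \<le> B" "\<And>x. norm x > R \<Longrightarrow> f x = 0"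
    using test_funE[OF assms] by metis
  show ?thesis
    by (rule integrableI_bounded_set[where A = "cball 0 R" and B = B])
       (use BR test_fun_measurable[OF assms] in \<open>auto simp: emeasure_lborel_cball_finite[unfolded infinity_ennreal_def]\<close>)
qed

lemma test_fun_bounded_mult:
  assumes "test_fun h" "f \<in> borel_measurable borel" "\<And>x. \<bar>f x\<bar> \<le> B"
  shows "test_fun (\<lambda>x. f x * h x)"
proof -
  obtain B' R where BR: "B' \<ge> 0" "\<And>x. \<bar>h x\<bar> \<le> B'" "\<And>x. norm x > R \<Longrightarrow> h x = 0"
    using test_funE[OF assms(1)] by metis
  have B0: "B \<ge> 0" using assms(3)[of 0] by linarith
  show ?thesis
  proof (rule test_funI)
    show "(\<lambda>x. f x * h x) \<in> borel_measurable borel"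
      using assms(2) test_fun_measurable[OF assms(1)] by simp
    show "\<bar>f x * h x\<bar> \<le> B * B'" for x
      using assms(3)[of x] BR(1) BR(2)[of x] B0 by (simp add: abs_mult mult_mono)
    show "norm x > R \<Longrightarrow> f x * h x = 0" for x using BR by simp
  qed
qed

lemma test_fun_mult:
  assumes "test_fun f" "test_fun h" shows "test_fun (\<lambda>x. f x * h x)"
  using test_funE[OF assms(1)] test_fun_bounded_mult[OF assms(2) test_fun_measurable[OF assms(1)]] by metis

lemma test_fun_diff:
  assumes "test_fun f" "test_fun g" shows "test_fun (\<lambda>x. f x - g x)"
proof -
  obtain B R where BR: "\<And>x. \<bar>f x\<bar> \<le> B" "\<And>x. norm x > R \<Longrightarrow> f x = 0"
    using test_funE[OF assms(1)] by metis
  obtain B' R' where BR': "\<And>x. \<bar>g x\<bar> \<le> B'" "\<And>x. norm x > R' \<Longrightarrow> g x = 0"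
    using test_funE[OF assms(2)] by metis
  show ?thesis
  proof (rule test_funI)
    show "(\<lambda>x. f x - g x) \<in> borel_measurable borel"
      using assms test_fun_measurable by (intro borel_measurable_diff) auto
    show "\<bar>f x - g x\<bar> \<le> B + B'" for x
      using BR(1)[of x] BR'(1)[of x] by linarith
    show "norm x > max R R' \<Longrightarrow> f x - g x = 0" for x using BR BR' by simp
  qed
qed

lemma test_fun_translate:
  assumes "test_fun h" shows "test_fun (\<lambda>y. h (w + y))"
proof -
  obtain B R where BR: "\<And>x. \<bar>h x\<bar> \<le> B" "\<And>x. norm x > R \<Longrightarrow> h x = 0"
    using test_funE[OF assms] by metis
  show ?thesis
  proof (rule test_funI)
    show "(\<lambda>y. h (w + y)) \<in> borel_measurable borel"
      using test_fun_measurable[OF assms] by measurable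
    show "\<bar>h (w + x)\<bar> \<le> B" for x using BR by simp
    show "h (w + x) = 0" if "norm x > R + norm w" for x
    proof -
      have "norm x \<le> norm (w + x) + norm w" using norm_triangle_ineq4[of "w+x" w] by simp
      then show ?thesis using that BR by simp
    qed
  qed
qed

lemma test_fun_reflect:
  assumes "test_fun h" shows "test_fun (\<lambda>y. h (- y))"
proof -
  obtain B R where BR: "\<And>x. \<bar>h x\<bar> \<le> B" "\<And>x. norm x > R \<Longrightarrow> h x = 0"
    using test_funE[OF assms] by metis
  show ?thesis
  proof (rule test_funI)
    show "(\<lambda>y. h (- y)) \<in> borel_measurable borel"
      using test_fun_measurable[OF assms] by measurable
    show "norm x > R \<Longrightarrow> h (- x) = 0" for x using BR by simp
  qed (use BR in auto)
qed

lemma test_fun_indicator: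
  fixes A :: "'a::euclidean_space set"
  assumes "A \<in> sets borel" "bounded A"
  shows "test_fun (indicat_real A)"
proof -
  obtain R where R: "\<And>x. x \<in> A \<Longrightarrow> norm x \<le> R" using assms(2) unfolding bounded_iff by blast
  show ?thesis
    by (rule test_funI[of _ 1 R]) (use assms(1) R in \<open>force simp: indicator_def\<close>)+
qed

lemma lborel_integral_shift:
  fixes f :: "'a::euclidean_space \<Rightarrow> real"
  shows "(LINT y|lborel. f (w + y)) = (LINT y|lborel. f y)"
proof (cases "f \<in> borel_measurable borel")
  case True
  have "(LINT y|lborel. f y) = (LINT y|distr lborel borel ((+) w). f y)"
    by (simp add: lborel_distr_plus)
  also have "\<dots> = (LINT y|lborel. f (w + y))"
    by (rule integral_distr) (use True in auto)
  finally show ?thesis by simp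
next
  \<comment> \<open>If \<open>f\<close> is not Borel, neither is its translate, and both integrals
    take the default value 0.\<close>
  case False
  have "\<not> integrable lborel f" using False by auto
  moreover have "(\<lambda>y. f (w + y)) \<notin> borel_measurable borel"
  proof
    assume "(\<lambda>y. f (w + y)) \<in> borel_measurable borel"
    then have "(\<lambda>y. f (w + (y - w))) \<in> borel_measurable borel" by measurable
    then show False using False by simp
  qed
  then have "\<not> integrable lborel (\<lambda>y. f (w + y))" by auto
  ultimately show ?thesis by (simp add: not_integrable_integral_eq)
qed

text \<open>This pairs \<open>h\<close> with the translate of \<open>f\<close> centred at
  \<open>x\<close>. As an operator on \<open>h\<close> it is the transpose of convolution with
  \<open>f\<close>, so integrating a hex-spline against \<open>h\<close> means evaluating at the
  centre of its cell.\<close>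

definition corr :: "('a::euclidean_space \<Rightarrow> real) \<Rightarrow> ('a \<Rightarrow> real) \<Rightarrow> 'a \<Rightarrow> real" where
  "corr f h x = (LINT y|lborel. f y * h (x + y))"

lemma corr_translate: "corr f h (x + w) = corr (\<lambda>y. f (y - w)) h x"
  unfolding corr_def using lborel_integral_shift[of "\<lambda>y. f (y - w) * h (x + y)" w]
  by (simp add: add.assoc)

lemma test_fun_corr:
  assumes "test_fun f" "test_fun h" shows "test_fun (corr f h)"
proof -
  obtain B R where BR: "\<And>x. \<bar>h x\<bar> \<le> B" "\<And>x. norm x > R \<Longrightarrow> h x = 0"
    using test_funE[OF assms(2)] by metis
  obtain R' where R': "\<And>x. norm x > R' \<Longrightarrow> f x = 0"
    using test_funE[OF assms(1)] by metis
  have [measurable]: "f \<in> borel_measurable borel" "h \<in> borel_measurable borel"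
    using assms test_fun_measurable by auto
  have int: "integrable lborel (\<lambda>y. f y * h (x + y))" for x
    by (intro test_fun_integrable test_fun_mult assms test_fun_translate)
  show ?thesis
  proof (rule test_funI)
    show "corr f h \<in> borel_measurable borel"
      unfolding corr_def
      by measurable
    show "\<bar>corr f h x\<bar> \<le> (LINT y|lborel. \<bar>f y\<bar> * B)" for x
    proof -
      have "\<bar>corr f h x\<bar> \<le> (LINT y|lborel. \<bar>f y * h (x + y)\<bar>)"
        unfolding corr_def by (rule integral_abs_bound)
      also have "\<dots> \<le> (LINT y|lborel. \<bar>f y\<bar> * B)"
      proof (rule integral_mono)
        show "integrable lborel (\<lambda>y. \<bar>f y * h (x + y)\<bar>)" by (rule integrable_abs[OF int])
        show "integrable lborel (\<lambda>y. \<bar>f y\<bar> * B)"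
          using test_fun_integrable[OF assms(1)] by simp
        show "\<bar>f y * h (x + y)\<bar> \<le> \<bar>f y\<bar> * B" for y
          using BR(1)[of "x + y"] by (simp add: abs_mult mult_left_mono)
      qed
      finally show ?thesis .
    qed
    show "corr f h x = 0" if "norm x > R + R'" for x
    proof -
      have "f y * h (x + y) = 0" for y
      proof (cases "norm y > R'")
        case False
        have "norm x \<le> norm (x + y) + norm y" using norm_triangle_ineq4[of "x+y" y] by simp
        then show ?thesis using that False BR by simp
      qed (use R' in simp)
      then have "(\<lambda>y. f y * h (x + y)) = (\<lambda>_. 0)" by blast
      then show ?thesis unfolding corr_def by simp
    qed
  qed
qed

lemma convolution_eq_corr: "convolution f g x = corr f (\<lambda>y. g (- y)) (- x)"
  unfolding convolution_def corr_def by simp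

lemma test_fun_convolution:
  assumes "test_fun f" "test_fun g" shows "test_fun (convolution f g)"
proof -
  have "convolution f g = (\<lambda>x. corr f (\<lambda>y. g (- y)) (- x))"
    using convolution_eq_corr by blast
  then show ?thesis
    using test_fun_reflect[OF test_fun_corr[OF assms(1) test_fun_reflect[OF assms(2)]]] by simp
qed

text \<open>Fubini and the substitution of \<open>y + x\<close> for \<open>x\<close> turn a
  convolution into a composition of operators. A spline of order \<open>k\<close> is thereby handled
  as \<open>k\<close> applications of one operator, without any formula for its values.\<close>

lemma corr_convolution:
  fixes f g h :: "real ^ 2 \<Rightarrow> real"
  assumes "test_fun f" "test_fun g" "test_fun h"
  shows "corr (convolution f g) h = corr g (corr f h)"
proof
  fix d
  have [measurable]: "f \<in> borel_measurable borel" "g \<in> borel_measurable borel"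
    "h \<in> borel_measurable borel"
    using assms test_fun_measurable by auto
  obtain Bf Rf where f: "Bf \<ge> 0" "Rf \<ge> 0" "\<And>x. \<bar>f x\<bar> \<le> Bf" "\<And>x. norm x > Rf \<Longrightarrow> f x = 0"
    using test_funE[OF assms(1)] by metis
  obtain Bg Rg where g: "Bg \<ge> 0" "Rg \<ge> 0" "\<And>x. \<bar>g x\<bar> \<le> Bg" "\<And>x. norm x > Rg \<Longrightarrow> g x = 0"
    using test_funE[OF assms(2)] by metis
  obtain Bh Rh where h: "Bh \<ge> 0" "\<And>x. \<bar>h x\<bar> \<le> Bh"
    using test_funE[OF assms(3)] by metis
  have pr: "norm (x :: real ^ 2, y :: real ^ 2) \<le> norm x + norm y" for x y
    by (rule norm_Pair_le)
  \<comment> \<open>Both double integrals, before and after the substitution, have test functions on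
    the product space as integrands, so they converge absolutely.\<close>
  have n1: "test_fun (\<lambda>(x, y). f y * g (x - y) * h (d + x))"
  proof (rule test_funI)
    show "(\<lambda>(x, y). f y * g (x - y) * h (d + x)) \<in> borel_measurable borel"
      unfolding borel_prod[symmetric] by measurable
    show "\<bar>case z of (x, y) \<Rightarrow> f y * g (x - y) * h (d + x)\<bar> \<le> Bf * Bg * Bh" for z
      using f g h by (auto simp: abs_mult split: prod.split intro!: mult_mono)
    show "(case z of (x, y) \<Rightarrow> f y * g (x - y) * h (d + x)) = 0" if "norm z > Rf + (Rf + Rg)" for z
    proof -
      obtain x y where z: "z = (x, y)" by fastforce
      have "norm x \<le> norm (x - y) + norm y" using norm_triangle_ineq[of "x-y" y] by simp
      then have "norm y > Rf \<or> norm (x - y) > Rg" using that pr[of x y] unfolding z by linarith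
      then show ?thesis using f g z by auto
    qed
  qed
  have n2: "test_fun (\<lambda>(x, y). f y * g x * h (d + (y + x)))"
  proof (rule test_funI)
    show "(\<lambda>(x, y). f y * g x * h (d + (y + x))) \<in> borel_measurable borel"
      unfolding borel_prod[symmetric] by measurable
    show "\<bar>case z of (x, y) \<Rightarrow> f y * g x * h (d + (y + x))\<bar> \<le> Bf * Bg * Bh" for z
      using f g h by (auto simp: abs_mult split: prod.split intro!: mult_mono)
    show "(case z of (x, y) \<Rightarrow> f y * g x * h (d + (y + x))) = 0" if "norm z > Rf + Rg" for z
    proof -
      obtain x y where z: "z = (x, y)" by fastforce
      have "norm y > Rf \<or> norm x > Rg" using that pr[of x y] unfolding z by linarith
      then show ?thesis using f g z by auto
    qed
  qed
  have i1: "integrable (lborel \<Otimes>\<^sub>M lborel) (\<lambda>(x, y). f y * g (x - y) * h (d + x))"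
    using test_fun_integrable[OF n1] by (simp add: lborel_prod)
  have i2: "integrable (lborel \<Otimes>\<^sub>M lborel) (\<lambda>(x, y). f y * g x * h (d + (y + x)))"
    using test_fun_integrable[OF n2] by (simp add: lborel_prod)
  have "corr (convolution f g) h d = (LINT x|lborel. LINT y|lborel. f y * g (x - y) * h (d + x))"
    unfolding corr_def convolution_def by simp
  also have "\<dots> = (LINT y|lborel. LINT x|lborel. f y * g (x - y) * h (d + x))"
    by (rule lborel_pair.Fubini_integral[OF i1, symmetric])
  also have "\<dots> = (LINT y|lborel. LINT x|lborel. f y * g x * h (d + (y + x)))"
  proof (rule Bochner_Integration.integral_cong[OF refl])
    fix y
    show "(LINT x|lborel. f y * g (x - y) * h (d + x)) = (LINT x|lborel. f y * g x * h (d + (y + x)))"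
      using lborel_integral_shift[of "\<lambda>x. f y * g (x - y) * h (d + x)" y] by simp
  qed
  also have "\<dots> = (LINT x|lborel. LINT y|lborel. f y * g x * h (d + (y + x)))"
    by (rule lborel_pair.Fubini_integral[OF i2])
  also have "\<dots> = (LINT x|lborel. g x * (LINT y|lborel. f y * h (d + x + y)))"
    by (simp add: ac_simps flip: integral_mult_right_zero)
  also have "\<dots> = corr g (corr f h) d" unfolding corr_def ..
  finally show "corr (convolution f g) h d = corr g (corr f h) d" .
qed

lemma conv_power_Suc: "k \<ge> 1 \<Longrightarrow> conv_power f (Suc k) = convolution f (conv_power f k)"
  unfolding conv_power_def by (cases k) auto

lemma conv_power_1: "conv_power f (Suc 0) = f"
  unfolding conv_power_def by simp

lemma test_fun_conv_power:
  assumes "test_fun f" "k \<ge> 1" shows "test_fun (conv_power f k)"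
  using assms(2)
proof (induction k rule: dec_induct)
  case (step n)
  then show ?case using assms(1) by (simp add: conv_power_Suc test_fun_convolution)
qed (use assms(1) in \<open>simp add: conv_power_1\<close>)

lemma corr_conv_power:
  assumes "test_fun f" "k \<ge> 1" "test_fun h"
  shows "corr (conv_power f k) h = (corr f ^^ k) h"
  using assms(2,3)
proof (induction k arbitrary: h rule: dec_induct)
  case base
  then show ?case by (simp add: conv_power_1)
next
  case (step n)
  then show ?case
    by (simp add: conv_power_Suc corr_convolution test_fun_conv_power test_fun_corr assms(1) funpow_swap1)
qed

section \<open>Translation differences\<close>

definition delta :: "'a::euclidean_space \<Rightarrow> ('a \<Rightarrow> real) \<Rightarrow> 'a \<Rightarrow> real" where
  "delta w h x = h x - h (x + w)"

lemma test_fun_delta: "test_fun h \<Longrightarrow> test_fun (delta w h)"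
  unfolding delta_def using test_fun_diff[OF _ test_fun_translate[of h w]] by (simp add: add.commute)

lemma delta_commute: "delta u (delta w h) = delta w (delta u h)"
  by (auto simp: delta_def fun_eq_iff algebra_simps)

text \<open>Bounded support is asked of \<open>h\<close> only, because the lemma is to be applied to
  indicators of unbounded cones.\<close>

lemma corr_delta:
  assumes "f \<in> borel_measurable borel" "\<And>x. \<bar>f x\<bar> \<le> B" "test_fun h"
  shows "corr f (delta w h) x = corr (\<lambda>y. f y - f (y - w)) h x"
proof -
  have [measurable]: "f \<in> borel_measurable borel" by fact
  have i: "integrable lborel (\<lambda>y. f y * h (x' + y))" for x'
    by (rule test_fun_integrable[OF test_fun_bounded_mult[OF test_fun_translate[OF assms(3)] assms(1,2)]])
  have i': "integrable lborel (\<lambda>y. f (y - w) * h (x + y))"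
    by (intro test_fun_integrable test_fun_bounded_mult[where B = B] test_fun_translate assms) (use assms in auto)
  have "corr f (delta w h) x = (LINT y|lborel. f y * h (x + y) - f y * h (x + w + y))"
    unfolding corr_def delta_def by (simp add: algebra_simps)
  also have "\<dots> = corr f h x - corr f h (x + w)"
    unfolding corr_def using i by simp
  also have "\<dots> = (LINT y|lborel. f y * h (x + y) - f (y - w) * h (x + y))"
    unfolding corr_translate unfolding corr_def using i[of x] i' by simp
  also have "\<dots> = corr (\<lambda>y. f y - f (y - w)) h x"
    unfolding corr_def by (simp add: algebra_simps)
  finally show ?thesis .
qed

lemma corr_delta_commute:
  assumes "test_fun f" "test_fun h"
  shows "corr f (delta w h) = delta w (corr f h)"
proof
  fix x
  have i: "integrable lborel (\<lambda>y. f y * h (x' + y))" for x'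
    by (intro test_fun_integrable test_fun_mult test_fun_translate assms)
  have "corr f (delta w h) x = (LINT y|lborel. f y * h (x + y) - f y * h (x + w + y))"
    unfolding corr_def delta_def by (simp add: algebra_simps)
  also have "\<dots> = delta w (corr f h) x"
    unfolding corr_def delta_def using i by simp
  finally show "corr f (delta w h) x = delta w (corr f h) x" .
qed

section \<open>Hexagons, cones and edge differences\<close>

lemma AE_hyperplane:
  fixes v :: "'a::euclidean_space"
  assumes "v \<noteq> 0" shows "AE y in lborel. v \<bullet> y \<noteq> c"
proof -
  have "negligible {y. v \<bullet> y = c}" by (rule negligible_hyperplane) (use assms in simp)
  moreover have "{y. v \<bullet> y = c} \<in> sets lborel" by (simp add: closed_hyperplane borel_closed)
  ultimately have "{y. v \<bullet> y = c} \<in> null_sets lborel"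
    by (simp add: negligible_iff_null_sets null_sets_completion_iff)
  from AE_not_in[OF this] show ?thesis by simp
qed

text \<open>For fixed \<open>s\<close> this is an identity between half-lines in \<open>u\<close>.
  For 0 \<le> \<open>s\<close> < \<rho> the right side collapses to [-\<rho> \<le> \<open>u\<close>]
  - [\<rho> \<le> \<open>s + u\<close>], for -\<rho> \<le> \<open>s\<close> < 0 to
  [-\<rho> \<le> \<open>s + u\<close>] - [\<rho> \<le> \<open>u\<close>], and for other
  \<open>s\<close> everything cancels. Off the six excluded lines, strict and weak inequalities in
  the hexagon agree.\<close>

lemma hexagon_cone_identity:
  fixes s u \<rho> :: real
  assumes "\<rho> > 0" "s \<noteq> \<rho>" "s \<noteq> - \<rho>" "u \<noteq> \<rho>" "u \<noteq> - \<rho>" "s + u \<noteq> \<rho>" "s + u \<noteq> - \<rho>"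
  shows "of_bool (\<bar>s\<bar> \<le> \<rho> \<and> \<bar>u\<bar> \<le> \<rho> \<and> \<bar>s + u\<bar> \<le> \<rho>) =
    of_bool (0 \<le> s \<and> \<rho> \<le> u) - of_bool (- \<rho> \<le> s \<and> \<rho> \<le> u)
    + of_bool (0 \<le> s \<and> - \<rho> \<le> u) - of_bool (\<rho> \<le> s \<and> - \<rho> \<le> u)
    + of_bool (s < 0 \<and> \<rho> \<le> s + u) - of_bool (s < \<rho> \<and> \<rho> \<le> s + u)
    + of_bool (s < 0 \<and> - \<rho> \<le> s + u) - (of_bool (s < - \<rho> \<and> - \<rho> \<le> s + u) :: real)"
proof -
  have 1: "(\<bar>s\<bar> \<le> \<rho> \<and> \<bar>u\<bar> \<le> \<rho> \<and> \<bar>s + u\<bar> \<le> \<rho>) \<longleftrightarrow>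
    - \<rho> \<le> s \<and> \<not> \<rho> \<le> s \<and> - \<rho> \<le> u \<and> \<not> \<rho> \<le> u \<and> - \<rho> \<le> s + u \<and> \<not> \<rho> \<le> s + u"
    using assms by linarith
  have 2: "s < t \<longleftrightarrow> \<not> t \<le> s" for t by linarith
  consider (A) "\<rho> \<le> s" | (B) "0 \<le> s" "\<not> \<rho> \<le> s" | (C) "- \<rho> \<le> s" "\<not> 0 \<le> s" | (D) "\<not> - \<rho> \<le> s"
    by blast
  then show ?thesis
  proof cases
    case A
    then have "0 \<le> s" "- \<rho> \<le> s" using assms(1) by linarith+
    then show ?thesis using A unfolding 1 2 by simp
  next
    case B
    have "- \<rho> \<le> s" using B assms(1) by linarith
    moreover have "\<rho> \<le> u \<Longrightarrow> \<rho> \<le> s + u" "- \<rho> \<le> u \<Longrightarrow> - \<rho> \<le> s + u" "\<rho> \<le> s + u \<Longrightarrow> - \<rho> \<le> u"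
      using B assms(1) by linarith+
    ultimately show ?thesis using B unfolding 1 2
      by (cases "\<rho> \<le> u"; cases "- \<rho> \<le> u"; cases "\<rho> \<le> s + u"; cases "- \<rho> \<le> s + u") simp_all
  next
    case C
    have "\<not> \<rho> \<le> s" using C assms(1) by linarith
    moreover have "\<rho> \<le> u \<Longrightarrow> - \<rho> \<le> s + u" "\<rho> \<le> s + u \<Longrightarrow> \<rho> \<le> u" "- \<rho> \<le> s + u \<Longrightarrow> - \<rho> \<le> u"
      using C assms(1) by linarith+
    ultimately show ?thesis using C unfolding 1 2
      by (cases "\<rho> \<le> u"; cases "- \<rho> \<le> u"; cases "\<rho> \<le> s + u"; cases "- \<rho> \<le> s + u") simp_all
  next
    case D
    have "\<not> \<rho> \<le> s" "\<not> 0 \<le> s" using D assms(1) by linarith+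
    then show ?thesis using D unfolding 1 2 by simp
  qed
qed

text \<open>Coordinates adapted to the tessellation: \<open>a\<close> and \<open>b\<close> are two adjacent vertices of the hexagon
  centred at the origin and \<open>p\<close>, \<open>q\<close> is the dual basis. The vertices are \<open>\<plusminus>a\<close>, \<open>\<plusminus>b\<close>,
  \<open>\<plusminus>(b - a)\<close>, and the edges have the directions \<open>a\<close>, \<open>b\<close>, \<open>b - a\<close>.\<close>

locale hex_frame =
  fixes a b p q :: "real ^ 2"
  assumes pa: "p \<bullet> a = 1" and pb: "p \<bullet> b = 0" and qa: "q \<bullet> a = 0" and qb: "q \<bullet> b = 1"
    and frame_expand: "\<And>x. x = (p \<bullet> x) *\<^sub>R a + (q \<bullet> x) *\<^sub>R b"
begin

lemmas frame_simps = pa pb qa qb inner_add_right inner_diff_right inner_scaleR_right inner_minus_right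

text \<open>The intersection of three strips, one for each pair of opposite edges;
  \<open>convex_hull_hexset\<close> identifies it with the hull of the six scaled vertices.\<close>

definition hexset :: "real \<Rightarrow> (real ^ 2) set" where
  "hexset \<rho> = {y. \<bar>p \<bullet> y\<bar> \<le> \<rho> \<and> \<bar>q \<bullet> y\<bar> \<le> \<rho> \<and> \<bar>p \<bullet> y + q \<bullet> y\<bar> \<le> \<rho>}"

text \<open>\<open>cone1\<close> is spanned by \<open>a\<close> and \<open>b\<close>,
  \<open>cone2\<close> by \<open>b\<close> and \<open>b - a\<close>, and the tiles are the
  parallelograms of side factor \<epsilon> at their apices. With these boundary conventions the
  telescoping of indicators below is exact at every point.\<close>

definition cone1 :: "(real ^ 2) set" where
  "cone1 = {y. 0 \<le> p \<bullet> y \<and> 0 \<le> q \<bullet> y}"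

definition cone2 :: "(real ^ 2) set" where
  "cone2 = {y. p \<bullet> y < 0 \<and> 0 \<le> p \<bullet> y + q \<bullet> y}"

definition tile1 :: "real \<Rightarrow> (real ^ 2) set" where
  "tile1 \<epsilon> = {y. 0 \<le> p \<bullet> y \<and> p \<bullet> y < \<epsilon> \<and> 0 \<le> q \<bullet> y \<and> q \<bullet> y < \<epsilon>}"

definition tile2 :: "real \<Rightarrow> (real ^ 2) set" where
  "tile2 \<epsilon> = {y. - \<epsilon> \<le> p \<bullet> y \<and> p \<bullet> y < 0 \<and> 0 \<le> p \<bullet> y + q \<bullet> y \<and> p \<bullet> y + q \<bullet> y < \<epsilon>}"

definition edge_diff :: "real \<Rightarrow> (real ^ 2 \<Rightarrow> real) \<Rightarrow> real ^ 2 \<Rightarrow> real" where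
  "edge_diff \<epsilon> h = delta (\<epsilon> *\<^sub>R a) (delta (\<epsilon> *\<^sub>R b) (delta (\<epsilon> *\<^sub>R (b - a)) h))"

text \<open>The signs are those of the four translates of \<open>cone1\<close> in
  \<open>hexset_decomposition\<close>; their apices are the ends of the two edges parallel to
  \<open>a\<close>.\<close>

definition vertex_op :: "real \<Rightarrow> (real ^ 2 \<Rightarrow> real) \<Rightarrow> real ^ 2 \<Rightarrow> real" where
  "vertex_op \<rho> g z = g (z + \<rho> *\<^sub>R b) - g (z + \<rho> *\<^sub>R (b - a)) + g (z - \<rho> *\<^sub>R b) - g (z + \<rho> *\<^sub>R (a - b))"

lemma norm_frame: "norm x \<le> \<bar>p \<bullet> x\<bar> * norm a + \<bar>q \<bullet> x\<bar> * norm b"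
  by (subst frame_expand[of x]) (metis norm_triangle_ineq norm_scaleR)

lemma bounded_box:
  assumes "\<And>y. y \<in> A \<Longrightarrow> \<bar>p \<bullet> y\<bar> \<le> R \<and> \<bar>q \<bullet> y\<bar> \<le> R"
  shows "bounded A"
proof -
  have "norm y \<le> R * norm a + R * norm b" if "y \<in> A" for y
    using norm_frame[of y] assms[OF that]
    by (meson add_mono mult_right_mono norm_ge_zero order_trans)
  then show ?thesis by (auto simp: bounded_iff)
qed

lemma borel_sets [measurable]:
  "hexset \<rho> \<in> sets borel" "cone1 \<in> sets borel" "cone2 \<in> sets borel"
  "tile1 \<epsilon> \<in> sets borel" "tile2 \<epsilon> \<in> sets borel"
  unfolding hexset_def cone1_def cone2_def tile1_def tile2_def by measurable

lemma test_fun_hexset: "test_fun (indicat_real (hexset \<rho>))"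
  by (rule test_fun_indicator[OF _ bounded_box[where R = \<rho>]]) (auto simp: hexset_def borel_sets)

lemma test_fun_tile1: "test_fun (indicat_real (tile1 \<epsilon>))"
  by (rule test_fun_indicator[OF _ bounded_box[where R = \<epsilon>]]) (auto simp: tile1_def borel_sets)

lemma test_fun_edge_diff: "test_fun h \<Longrightarrow> test_fun (edge_diff \<epsilon> h)"
  unfolding edge_diff_def by (intro test_fun_delta)

lemma hexset_decomposition:
  assumes "\<rho> > 0"
  shows "AE y in lborel. indicat_real (hexset \<rho>) y =
    indicator cone1 (y - \<rho> *\<^sub>R b) - indicator cone1 (y - \<rho> *\<^sub>R (b - a))
    + indicator cone1 (y - (- \<rho>) *\<^sub>R b) - indicator cone1 (y - \<rho> *\<^sub>R (a - b))
    + indicator cone2 (y - \<rho> *\<^sub>R b) - indicator cone2 (y - \<rho> *\<^sub>R a)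
    + indicator cone2 (y - (- \<rho>) *\<^sub>R b) - indicator cone2 (y - (- \<rho>) *\<^sub>R a)"
proof -
  have nz: "p \<noteq> 0" "q \<noteq> 0" "p + q \<noteq> 0"
    using pa qb pb by (auto simp: add_eq_0_iff)
  have "AE y in lborel. p \<bullet> y \<noteq> \<rho> \<and> p \<bullet> y \<noteq> - \<rho> \<and> q \<bullet> y \<noteq> \<rho> \<and> q \<bullet> y \<noteq> - \<rho> \<and>
      (p + q) \<bullet> y \<noteq> \<rho> \<and> (p + q) \<bullet> y \<noteq> - \<rho>"
    using nz by (simp add: AE_conj_iff AE_hyperplane)
  then show ?thesis
  proof eventually_elim
    case (elim y)
    define s u where su: "s = p \<bullet> y" "u = q \<bullet> y"
    have m: "y \<in> hexset \<rho> \<longleftrightarrow> \<bar>s\<bar> \<le> \<rho> \<and> \<bar>u\<bar> \<le> \<rho> \<and> \<bar>s + u\<bar> \<le> \<rho>"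
      "y - \<rho> *\<^sub>R b \<in> cone1 \<longleftrightarrow> 0 \<le> s \<and> \<rho> \<le> u"
      "y - \<rho> *\<^sub>R (b - a) \<in> cone1 \<longleftrightarrow> - \<rho> \<le> s \<and> \<rho> \<le> u"
      "y - (- \<rho>) *\<^sub>R b \<in> cone1 \<longleftrightarrow> 0 \<le> s \<and> - \<rho> \<le> u"
      "y - \<rho> *\<^sub>R (a - b) \<in> cone1 \<longleftrightarrow> \<rho> \<le> s \<and> - \<rho> \<le> u"
      "y - \<rho> *\<^sub>R b \<in> cone2 \<longleftrightarrow> s < 0 \<and> \<rho> \<le> s + u"
      "y - \<rho> *\<^sub>R a \<in> cone2 \<longleftrightarrow> s < \<rho> \<and> \<rho> \<le> s + u"
      "y - (- \<rho>) *\<^sub>R b \<in> cone2 \<longleftrightarrow> s < 0 \<and> - \<rho> \<le> s + u"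
      "y - (- \<rho>) *\<^sub>R a \<in> cone2 \<longleftrightarrow> s < - \<rho> \<and> - \<rho> \<le> s + u"
      unfolding hexset_def cone1_def cone2_def mem_Collect_eq su frame_simps by auto
    have "s \<noteq> \<rho>" "s \<noteq> - \<rho>" "u \<noteq> \<rho>" "u \<noteq> - \<rho>" "s + u \<noteq> \<rho>" "s + u \<noteq> - \<rho>"
      using elim by (auto simp: su inner_add_left)
    from hexagon_cone_identity[OF assms this] show ?case
      unfolding indicator_def m by simp
  qed
qed

lemma corr_hexset:
  assumes "\<rho> > 0" "test_fun h"
  shows "corr (indicat_real (hexset \<rho>)) h x =
    corr (indicator cone1) h (x + \<rho> *\<^sub>R b) - corr (indicator cone1) h (x + \<rho> *\<^sub>R (b - a))
    + corr (indicator cone1) h (x + (- \<rho>) *\<^sub>R b) - corr (indicator cone1) h (x + \<rho> *\<^sub>R (a - b))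
    + corr (indicator cone2) h (x + \<rho> *\<^sub>R b) - corr (indicator cone2) h (x + \<rho> *\<^sub>R a)
    + corr (indicator cone2) h (x + (- \<rho>) *\<^sub>R b) - corr (indicator cone2) h (x + (- \<rho>) *\<^sub>R a)"
proof -
  have i: "integrable lborel (\<lambda>y. indicat_real A (y - w) * h (x + y))" if "A \<in> sets borel" for A w
  proof (rule test_fun_integrable, rule test_fun_bounded_mult[where B = 1])
    show "(\<lambda>y. indicat_real A (y - w)) \<in> borel_measurable borel" using that by measurable
  qed (use assms test_fun_translate in \<open>auto simp: indicator_def\<close>)
  note i1 = i[OF borel_sets(2)] and i2 = i[OF borel_sets(3)]
  have "corr (indicat_real (hexset \<rho>)) h x = (LINT y|lborel.
      indicator cone1 (y - \<rho> *\<^sub>R b) * h (x + y) - indicator cone1 (y - \<rho> *\<^sub>R (b - a)) * h (x + y)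
    + indicator cone1 (y - (- \<rho>) *\<^sub>R b) * h (x + y) - indicator cone1 (y - \<rho> *\<^sub>R (a - b)) * h (x + y)
    + indicator cone2 (y - \<rho> *\<^sub>R b) * h (x + y) - indicator cone2 (y - \<rho> *\<^sub>R a) * h (x + y)
    + indicator cone2 (y - (- \<rho>) *\<^sub>R b) * h (x + y) - indicator cone2 (y - (- \<rho>) *\<^sub>R a) * h (x + y))"
    unfolding corr_def
  proof (rule integral_cong_AE)
    have [measurable]: "h \<in> borel_measurable borel" using assms test_fun_measurable by auto
    show "(\<lambda>y. indicat_real (hexset \<rho>) y * h (x + y)) \<in> borel_measurable lborel" by measurable
    show "(\<lambda>y. indicator cone1 (y - \<rho> *\<^sub>R b) * h (x + y) - indicator cone1 (y - \<rho> *\<^sub>R (b - a)) * h (x + y)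
    + indicator cone1 (y - (- \<rho>) *\<^sub>R b) * h (x + y) - indicator cone1 (y - \<rho> *\<^sub>R (a - b)) * h (x + y)
    + indicator cone2 (y - \<rho> *\<^sub>R b) * h (x + y) - indicator cone2 (y - \<rho> *\<^sub>R a) * h (x + y)
    + indicator cone2 (y - (- \<rho>) *\<^sub>R b) * h (x + y) - indicator cone2 (y - (- \<rho>) *\<^sub>R a) * h (x + y))
      \<in> borel_measurable lborel" by measurable
    show "AE y in lborel. indicat_real (hexset \<rho>) y * h (x + y) =
      indicator cone1 (y - \<rho> *\<^sub>R b) * h (x + y) - indicator cone1 (y - \<rho> *\<^sub>R (b - a)) * h (x + y)
    + indicator cone1 (y - (- \<rho>) *\<^sub>R b) * h (x + y) - indicator cone1 (y - \<rho> *\<^sub>R (a - b)) * h (x + y)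
    + indicator cone2 (y - \<rho> *\<^sub>R b) * h (x + y) - indicator cone2 (y - \<rho> *\<^sub>R a) * h (x + y)
    + indicator cone2 (y - (- \<rho>) *\<^sub>R b) * h (x + y) - indicator cone2 (y - (- \<rho>) *\<^sub>R a) * h (x + y)"
      using hexset_decomposition[OF assms(1)]
    proof eventually_elim
      case (elim y)
      show ?case unfolding elim by (simp only: left_diff_distrib distrib_right)
    qed
  qed
  also have "\<dots> = corr (indicator cone1) h (x + \<rho> *\<^sub>R b) - corr (indicator cone1) h (x + \<rho> *\<^sub>R (b - a))
    + corr (indicator cone1) h (x + (- \<rho>) *\<^sub>R b) - corr (indicator cone1) h (x + \<rho> *\<^sub>R (a - b))
    + corr (indicator cone2) h (x + \<rho> *\<^sub>R b) - corr (indicator cone2) h (x + \<rho> *\<^sub>R a)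
    + corr (indicator cone2) h (x + (- \<rho>) *\<^sub>R b) - corr (indicator cone2) h (x + (- \<rho>) *\<^sub>R a)"
    unfolding corr_translate unfolding corr_def
    by (simp only: Bochner_Integration.integral_add Bochner_Integration.integral_diff
        Bochner_Integration.integrable_add Bochner_Integration.integrable_diff i1 i2)
  finally show ?thesis .
qed

text \<open>Subtracting the copy of the cone shifted along one spanning direction leaves the
  half-strip \<open>S\<close>; doing the same along the other direction leaves the tile.\<close>

lemma corr_cone1_delta:
  assumes "\<epsilon> > 0" "test_fun h"
  shows "corr (indicator cone1) (delta (\<epsilon> *\<^sub>R a) (delta (\<epsilon> *\<^sub>R b) h)) x = corr (indicator (tile1 \<epsilon>)) h x"
proof -
  define S where "S = {y. 0 \<le> p \<bullet> y \<and> p \<bullet> y < \<epsilon> \<and> 0 \<le> q \<bullet> y}"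
  have [measurable]: "S \<in> sets borel" unfolding S_def by measurable
  have 1: "(\<lambda>y. indicat_real cone1 y - indicator cone1 (y - \<epsilon> *\<^sub>R a)) = indicator S"
    using assms by (auto simp: fun_eq_iff indicator_def cone1_def S_def frame_simps)
  have 2: "(\<lambda>y. indicat_real S y - indicator S (y - \<epsilon> *\<^sub>R b)) = indicator (tile1 \<epsilon>)"
    using assms by (auto simp: fun_eq_iff indicator_def tile1_def S_def frame_simps)
  have "corr (indicator cone1) (delta (\<epsilon> *\<^sub>R a) (delta (\<epsilon> *\<^sub>R b) h)) x =
      corr (indicator S) (delta (\<epsilon> *\<^sub>R b) h) x"
    unfolding 1[symmetric]
    by (rule corr_delta[where B = 1]) (use assms test_fun_delta in \<open>auto simp: indicator_def\<close>)
  also have "\<dots> = corr (indicator (tile1 \<epsilon>)) h x"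
    unfolding 2[symmetric]
    by (rule corr_delta[where B = 1]) (use assms test_fun_delta in \<open>auto simp: indicator_def\<close>)
  finally show ?thesis .
qed

lemma corr_cone2_delta:
  assumes "\<epsilon> > 0" "test_fun h"
  shows "corr (indicator cone2) (delta (\<epsilon> *\<^sub>R b) (delta (\<epsilon> *\<^sub>R (b - a)) h)) x =
    corr (indicator (tile2 \<epsilon>)) h x"
proof -
  define S where "S = {y. p \<bullet> y < 0 \<and> 0 \<le> p \<bullet> y + q \<bullet> y \<and> p \<bullet> y + q \<bullet> y < \<epsilon>}"
  have [measurable]: "S \<in> sets borel" unfolding S_def by measurable
  have 1: "(\<lambda>y. indicat_real cone2 y - indicator cone2 (y - \<epsilon> *\<^sub>R b)) = indicator S"
    using assms by (auto simp: fun_eq_iff indicator_def cone2_def S_def frame_simps)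
  have 2: "(\<lambda>y. indicat_real S y - indicator S (y - \<epsilon> *\<^sub>R (b - a))) = indicator (tile2 \<epsilon>)"
    using assms by (auto simp: fun_eq_iff indicator_def tile2_def S_def frame_simps)
  have "corr (indicator cone2) (delta (\<epsilon> *\<^sub>R b) (delta (\<epsilon> *\<^sub>R (b - a)) h)) x =
      corr (indicator S) (delta (\<epsilon> *\<^sub>R (b - a)) h) x"
    unfolding 1[symmetric]
    by (rule corr_delta[where B = 1]) (use assms test_fun_delta in \<open>auto simp: indicator_def\<close>)
  also have "\<dots> = corr (indicator (tile2 \<epsilon>)) h x"
    unfolding 2[symmetric]
    by (rule corr_delta[where B = 1]) (use assms test_fun_delta in \<open>auto simp: indicator_def\<close>)
  finally show ?thesis .
qed

section \<open>Exponential weights near a lattice point\<close>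

definition near :: "real \<Rightarrow> real ^ 2 \<Rightarrow> real ^ 2 \<Rightarrow> bool" where
  "near \<eta> z x \<longleftrightarrow> \<bar>p \<bullet> (x - z)\<bar> < \<eta> \<and> \<bar>q \<bullet> (x - z)\<bar> < \<eta>"

text \<open>The eigenvalue with which \<open>cone1\<close> after \<open>edge_diff\<close> acts on
  the weight \<open>exp (q \<bullet> x)\<close>. The factor \<open>1 - exp \<epsilon>\<close> comes
  from the difference along \<open>b - a\<close>, on which \<open>q\<close> takes the value
  1.\<close>

definition mass :: "real \<Rightarrow> real" where
  "mass \<epsilon> = (1 - exp \<epsilon>) * (LINT y|lborel. indicator (tile1 \<epsilon>) y * exp (q \<bullet> y))"

text \<open>A translation multiplies the exponential by a constant. All points sampled differ from
  \<open>x\<close> by less than \<open>3 * \<epsilon>\<close> in each frame coordinate, so they stay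
  in the window where \<open>G\<close> is known.\<close>

lemma corr_cone1_local:
  assumes "\<epsilon> > 0" "test_fun G" and G: "\<And>x. near \<eta> z x \<Longrightarrow> G x = c * exp (q \<bullet> (x - z))"
    and x: "near (\<eta> - 3 * \<epsilon>) z x"
  shows "corr (indicator cone1) (edge_diff \<epsilon> G) x = mass \<epsilon> * (c * exp (q \<bullet> (x - z)))"
proof -
  have "corr (indicator cone1) (edge_diff \<epsilon> G) x = corr (indicator (tile1 \<epsilon>)) (delta (\<epsilon> *\<^sub>R (b - a)) G) x"
    unfolding edge_diff_def by (intro corr_cone1_delta test_fun_delta assms)
  also have "\<dots> = (LINT y|lborel. indicator (tile1 \<epsilon>) y * exp (q \<bullet> y)
      * ((1 - exp \<epsilon>) * (c * exp (q \<bullet> (x - z)))))"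
    unfolding corr_def
  proof (rule Bochner_Integration.integral_cong[OF refl])
    fix y
    show "indicator (tile1 \<epsilon>) y * delta (\<epsilon> *\<^sub>R (b - a)) G (x + y) =
      indicator (tile1 \<epsilon>) y * exp (q \<bullet> y) * ((1 - exp \<epsilon>) * (c * exp (q \<bullet> (x - z))))"
    proof (cases "y \<in> tile1 \<epsilon>")
      case True
      have n: "near \<eta> z (x + y)" "near \<eta> z (x + y + \<epsilon> *\<^sub>R (b - a))"
        using True x assms(1) by (auto simp: near_def tile1_def frame_simps)
      have "q \<bullet> (x + y - z) = q \<bullet> y + q \<bullet> (x - z)"
        "q \<bullet> (x + y + \<epsilon> *\<^sub>R (b - a) - z) = q \<bullet> y + \<epsilon> + q \<bullet> (x - z)"
        by (simp_all add: frame_simps)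
      then have "G (x + y) = c * (exp (q \<bullet> y) * exp (q \<bullet> (x - z)))"
        "G (x + y + \<epsilon> *\<^sub>R (b - a)) = c * (exp (q \<bullet> y) * exp \<epsilon> * exp (q \<bullet> (x - z)))"
        by (simp_all only: G[OF n(1)] G[OF n(2)] exp_add)
      then show ?thesis
        using True unfolding delta_def by (simp add: algebra_simps)
    qed simp
  qed
  also have "\<dots> = mass \<epsilon> * (c * exp (q \<bullet> (x - z)))"
    unfolding mass_def by simp
  finally show ?thesis .
qed

text \<open>The weight \<open>exp (q \<bullet> x)\<close> is constant in the direction \<open>a\<close>, so the difference along \<open>a\<close>
  annihilates it. Hence only the vertices on the two edges parallel to \<open>a\<close> are visible.\<close>

lemma corr_cone2_local:
  assumes "\<epsilon> > 0" "test_fun G" and G: "\<And>x. near \<eta> z x \<Longrightarrow> G x = c * exp (q \<bullet> (x - z))"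
    and x: "near (\<eta> - 3 * \<epsilon>) z x"
  shows "corr (indicator cone2) (edge_diff \<epsilon> G) x = 0"
proof -
  have "edge_diff \<epsilon> G = delta (\<epsilon> *\<^sub>R b) (delta (\<epsilon> *\<^sub>R (b - a)) (delta (\<epsilon> *\<^sub>R a) G))"
    unfolding edge_diff_def by (metis delta_commute)
  then have "corr (indicator cone2) (edge_diff \<epsilon> G) x = corr (indicator (tile2 \<epsilon>)) (delta (\<epsilon> *\<^sub>R a) G) x"
    using corr_cone2_delta[OF assms(1) test_fun_delta[OF assms(2)]] by simp
  also have "\<dots> = (LINT y|(lborel :: (real ^ 2) measure). 0)"
    unfolding corr_def
  proof (rule Bochner_Integration.integral_cong[OF refl])
    fix y :: "real ^ 2"
    show "indicator (tile2 \<epsilon>) y * delta (\<epsilon> *\<^sub>R a) G (x + y) = 0"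
    proof (cases "y \<in> tile2 \<epsilon>")
      case True
      have n: "near \<eta> z (x + y)" "near \<eta> z (x + y + \<epsilon> *\<^sub>R a)"
        using True x assms(1) by (auto simp: near_def tile2_def frame_simps)
      show ?thesis
        using True by (simp add: delta_def G[OF n(1)] G[OF n(2)] frame_simps)
    qed simp
  qed
  finally show ?thesis by simp
qed

lemma mass_nonzero:
  assumes "\<epsilon> > 0" shows "mass \<epsilon> \<noteq> 0"
proof
  assume "mass \<epsilon> = 0"
  then have 0: "(LINT y|lborel. indicator (tile1 \<epsilon>) y * exp (q \<bullet> y)) = 0"
    using assms by (auto simp: mass_def)
  have "test_fun (\<lambda>y. indicator (tile1 \<epsilon>) y * exp (q \<bullet> y))"
  proof -
    obtain R where R: "\<And>x. norm x > R \<Longrightarrow> indicat_real (tile1 \<epsilon>) x = 0"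
      using test_funE[OF test_fun_tile1] by metis
    show ?thesis
    proof (rule test_funI)
      show "(\<lambda>y. indicator (tile1 \<epsilon>) y * exp (q \<bullet> y)) \<in> borel_measurable borel" by measurable
      show "\<bar>indicator (tile1 \<epsilon>) y * exp (q \<bullet> y)\<bar> \<le> exp \<epsilon>" for y
        by (auto simp: indicator_def tile1_def)
      show "norm x > R \<Longrightarrow> indicator (tile1 \<epsilon>) x * exp (q \<bullet> x) = 0" for x using R by simp
    qed
  qed
  from integral_nonneg_eq_0_iff_AE[OF test_fun_integrable[OF this]] 0
  have ae: "AE y in lborel. indicator (tile1 \<epsilon>) y * exp (q \<bullet> y) = (0 :: real)" by simp
  \<comment> \<open>\<open>U\<close> is the interior of \<open>tile1\<close>. The weight is positive
    there, so a vanishing integral would make this nonempty open set a null set.\<close>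
  define U where "U = {y. p \<bullet> y > 0} \<inter> {y. p \<bullet> y < \<epsilon>} \<inter> {y. q \<bullet> y > 0} \<inter> {y. q \<bullet> y < \<epsilon>}"
  have op: "open U" unfolding U_def
    by (intro open_Int open_halfspace_lt open_halfspace_gt)
  have "(\<epsilon> / 2) *\<^sub>R a + (\<epsilon> / 2) *\<^sub>R b \<in> U" using assms by (simp add: U_def frame_simps)
  then have "\<not> negligible U" using open_not_negligible[OF op] by blast
  moreover have "AE y in lborel. y \<notin> U"
    using ae by eventually_elim (auto simp: U_def tile1_def indicator_def split: if_splits)
  then have "U \<in> null_sets lborel"
    using op by (subst (asm) AE_iff_null_sets[symmetric]) auto
  then have "negligible U"
    using null_sets_completionI by (auto simp: negligible_iff_null_sets)
  ultimately show False by blast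
qed

text \<open>Moving \<open>x\<close> and \<open>z\<close> together by a vertex keeps their relative
  position, so all eight terms of \<open>corr_hexset\<close> share one exponential factor. The
  \<open>cone2\<close> terms vanish, and the \<open>cone1\<close> terms combine the amplitudes
  \<open>c\<close> as \<open>vertex_op\<close> does.\<close>

lemma step_local:
  assumes "\<epsilon> > 0" "\<rho> > 0" "test_fun G"
    and Z: "\<And>z i j. z \<in> Z \<Longrightarrow> z + (\<rho> * of_int i) *\<^sub>R a + (\<rho> * of_int j) *\<^sub>R b \<in> Z"
    and G: "\<And>z x. z \<in> Z \<Longrightarrow> near \<eta> z x \<Longrightarrow> G x = c z * exp (q \<bullet> (x - z))"
    and z: "z \<in> Z" and x: "near (\<eta> - 3 * \<epsilon>) z x"
  shows "corr (indicator (hexset \<rho>)) (edge_diff \<epsilon> G) x = mass \<epsilon> * vertex_op \<rho> c z * exp (q \<bullet> (x - z))"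
proof -
  have *: "corr (indicator cone1) (edge_diff \<epsilon> G) (x + w) = mass \<epsilon> * (c (z + w) * exp (q \<bullet> (x - z)))"
    "corr (indicator cone2) (edge_diff \<epsilon> G) (x + w) = 0"
    if "w = (\<rho> * of_int i) *\<^sub>R a + (\<rho> * of_int j) *\<^sub>R b" for w i j
  proof -
    have zw: "z + w \<in> Z" using Z[OF z, of i j] by (simp add: that add.assoc)
    have n: "near (\<eta> - 3 * \<epsilon>) (z + w) (x + w)" using x by (simp add: near_def)
    show "corr (indicator cone1) (edge_diff \<epsilon> G) (x + w) = mass \<epsilon> * (c (z + w) * exp (q \<bullet> (x - z)))"
      using corr_cone1_local[OF assms(1,3) G[OF zw] n] by simp
    show "corr (indicator cone2) (edge_diff \<epsilon> G) (x + w) = 0"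
      using corr_cone2_local[OF assms(1,3) G[OF zw] n] by simp
  qed
  have w: "\<rho> *\<^sub>R b = (\<rho> * of_int 0) *\<^sub>R a + (\<rho> * of_int 1) *\<^sub>R b"
    "\<rho> *\<^sub>R (b - a) = (\<rho> * of_int (-1)) *\<^sub>R a + (\<rho> * of_int 1) *\<^sub>R b"
    "(- \<rho>) *\<^sub>R b = (\<rho> * of_int 0) *\<^sub>R a + (\<rho> * of_int (-1)) *\<^sub>R b"
    "\<rho> *\<^sub>R (a - b) = (\<rho> * of_int 1) *\<^sub>R a + (\<rho> * of_int (-1)) *\<^sub>R b"
    "\<rho> *\<^sub>R a = (\<rho> * of_int 1) *\<^sub>R a + (\<rho> * of_int 0) *\<^sub>R b"
    "(- \<rho>) *\<^sub>R a = (\<rho> * of_int (-1)) *\<^sub>R a + (\<rho> * of_int 0) *\<^sub>R b"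
    by (simp_all add: algebra_simps)
  show ?thesis
    unfolding corr_hexset[OF assms(2) test_fun_edge_diff[OF assms(3)]]
      *(1)[OF w(1)] *(1)[OF w(2)] *(1)[OF w(3)] *(1)[OF w(4)]
      *(2)[OF w(1)] *(2)[OF w(5)] *(2)[OF w(3)] *(2)[OF w(6)] vertex_op_def
    by (simp add: algebra_simps)
qed

end

section \<open>Sequences on a residue class\<close>

definition bdiff :: "(nat \<Rightarrow> real) \<Rightarrow> nat \<Rightarrow> real" where
  "bdiff c n = c n - c (Suc n)"

lemma binomial_poly: "\<exists>P :: real poly. \<forall>n. poly P (real n) = real (n choose i)"
proof -
  let ?P = "smult (inverse (fact i)) (\<Prod>j<i. [:- real j, 1:]) :: real poly"
  have "poly ?P (real n) = real (n choose i)" for n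
    by (simp add: poly_prod binomial_gbinomial gbinomial_prod_rev field_simps lessThan_atLeast0)
  then show ?thesis by blast
qed

text \<open>This is Newton's expansion: summing the expansion of \<open>bdiff c\<close> raises every
  binomial coefficient by one order.\<close>

lemma bdiff_funpow_zero_newton:
  assumes "\<And>n. (bdiff ^^ k) c n = 0"
  shows "\<exists>d. \<forall>n. c n = (\<Sum>i<k. d i * real (n choose i))"
  using assms
proof (induction k arbitrary: c)
  case 0
  then show ?case by simp
next
  case (Suc k)
  have "(bdiff ^^ k) (bdiff c) n = 0" for n
    using Suc.prems[of n] by (simp add: funpow_swap1)
  from Suc.IH[OF this] obtain d where d: "\<And>n. bdiff c n = (\<Sum>i<k. d i * real (n choose i))" by blast
  \<comment> \<open>By Pascal's rule \<open>bdiff\<close> sends \<open>n choose Suc j\<close> to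
    minus \<open>n choose j\<close>, hence the sign; the constant of summation is
    \<open>c 0\<close>.\<close>
  define d' where "d' i = (case i of 0 \<Rightarrow> c 0 | Suc j \<Rightarrow> - d j)" for i
  have "c n = (\<Sum>i<Suc k. d' i * real (n choose i))" for n
  proof (induction n)
    case 0
    have "(\<Sum>i<k. d' (Suc i) * real (0 choose Suc i)) = 0" by simp
    then show ?case unfolding sum.lessThan_Suc_shift by (simp add: d'_def)
  next
    case (Suc n)
    have "c (Suc n) = c n - bdiff c n" by (simp add: bdiff_def)
    also have "\<dots> = (\<Sum>i<Suc k. d' i * real (Suc n choose i))"
      unfolding Suc d sum.lessThan_Suc_shift
      by (simp add: d'_def algebra_simps sum.distrib sum_negf sum_subtractf)
    finally show ?case .
  qed
  then show ?case by blast
qed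

lemma bdiff_funpow_zero_poly:
  assumes "\<And>n. (bdiff ^^ k) c n = 0"
  shows "\<exists>P :: real poly. \<forall>n. c n = poly P (real n)"
proof -
  obtain d where d: "\<And>n. c n = (\<Sum>i<k. d i * real (n choose i))"
    using bdiff_funpow_zero_newton[OF assms] by blast
  obtain Q :: "nat \<Rightarrow> real poly" where "\<And>i n. poly (Q i) (real n) = real (n choose i)"
    using binomial_poly by metis
  then have "c n = poly (\<Sum>i<k. smult (d i) (Q i)) (real n)" for n
    by (simp add: d poly_sum)
  then show ?thesis by blast
qed

lemma bdiff_funpow_zero_sparse:
  assumes "\<And>n. (bdiff ^^ k) c n = 0" and "infinite {n. c n = 0}"
  shows "c n = 0"
proof -
  obtain P :: "real poly" where P: "\<And>n. c n = poly P (real n)"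
    using bdiff_funpow_zero_poly[OF assms(1)] by blast
  have "real ` {n. c n = 0} \<subseteq> {x. poly P x = 0}" using P by auto
  moreover have "infinite (real ` {n. c n = 0})"
    using assms(2) by (simp add: finite_image_iff)
  ultimately have "infinite {x. poly P x = 0}" using finite_subset by blast
  then have "P = 0" using poly_roots_finite by blast
  then show ?thesis using P by simp
qed

lemma bdiff_funpow_shift: "(bdiff ^^ k) (\<lambda>n. c (n + m)) n = (bdiff ^^ k) c (n + m)"
proof (induction k arbitrary: n)
  case (Suc k)
  then show ?case using Suc[of "Suc n"] by (simp add: bdiff_def)
qed simp

text \<open>Expand the \<open>k\<close>-th power of 1 - S, where S is the shift: at index 1 only the
  term 1 sees a possibly nonzero value, at index 0 only the terms 1 and -\<open>k\<close> S.\<close>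

lemma bdiff_funpow_at_end:
  assumes "\<And>n. n \<ge> 2 \<Longrightarrow> c n = 0"
  shows "(bdiff ^^ k) c 1 = c 1 \<and> (bdiff ^^ k) c 0 = c 0 - real k * c 1 \<and> (\<forall>n\<ge>2. (bdiff ^^ k) c n = 0)"
proof (induction k)
  case (Suc k)
  have "(bdiff ^^ k) c (Suc (Suc 0)) = 0" using Suc by simp
  then show ?case using Suc by (simp add: bdiff_def algebra_simps)
qed (use assms in auto)

text \<open>Beyond the end of the support of the \<open>k\<close>-th difference, \<open>c\<close> is a polynomial with infinitely many
  zeros, so it vanishes there; the two last values of the difference then force \<open>c 1 = 1\<close> and
  \<open>c 0 = k\<close>, although \<open>c\<close> lives on a single residue class.\<close>

lemma no_sparse_spline:
  assumes "k \<ge> 1"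
    and sparse: "\<And>m n. c m \<noteq> 0 \<Longrightarrow> c n \<noteq> 0 \<Longrightarrow> m mod 3 = n mod 3"
    and "(bdiff ^^ k) c 0 = 0" "(bdiff ^^ k) c 1 = 1" "\<And>n. n \<ge> 2 \<Longrightarrow> (bdiff ^^ k) c n = 0"
  shows False
proof -
  have tail: "c (n + 2) = 0" for n
  proof (rule bdiff_funpow_zero_sparse[where k = k and c = "\<lambda>n. c (n + 2)"])
    show "(bdiff ^^ k) (\<lambda>n. c (n + 2)) n = 0" for n
      using assms(5) by (simp only: bdiff_funpow_shift)
    show "infinite {n. c (n + 2) = 0}"
    proof
      assume fin: "finite {n. c (n + 2) = 0}"
      \<comment> \<open>Two consecutive indices lie in different residue classes, so at least one of
        the two values is zero; this happens for every \<open>n\<close>, which gives infinitely many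
        zeros.\<close>
      have "c (3 * n + 2) = 0 \<or> c (3 * n + 1 + 2) = 0" for n
      proof -
        have "(3 * n + 2) mod 3 = 2" "(3 * n + 1 + 2) mod 3 = 0" by presburger+
        then show ?thesis using sparse[of "3 * n + 2" "3 * n + 1 + 2"] by fastforce
      qed
      then have "\<forall>m. \<exists>n\<ge>m. n \<in> {n. c (n + 2) = 0}"
        by (metis (mono_tags, lifting) le_add1 le_trans mem_Collect_eq mult_le_mono1 one_le_numeral mult_1)
      then show False using fin by (meson finite_nat_set_iff_bounded not_le)
    qed
  qed
  have "c n = 0" if "n \<ge> 2" for n using tail[of "n - 2"] le_add_diff_inverse2[OF that] by simp
  from bdiff_funpow_at_end[of c k, OF this] assms(3,4)
  have "c 1 = 1" "c 0 = real k" by auto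
  then show False using sparse[of 0 1] assms(1) by simp
qed

section \<open>The discrete refinement equation\<close>

lemma integer_translates_separated:
  fixes u \<rho> :: real
  assumes "\<rho> > 0"
  shows "\<exists>\<theta>>0. \<forall>i :: int. u + \<rho> * of_int i = 0 \<or> \<theta> \<le> \<bar>u + \<rho> * of_int i\<bar>"
proof -
  define f where "f = frac (u / \<rho>)"
  have f: "0 \<le> f" "f < 1" by (simp_all add: f_def frac_ge_0 frac_lt_1)
  have u: "u = \<rho> * (of_int \<lfloor>u / \<rho>\<rfloor> + f)" using assms by (simp add: f_def frac_def)
  \<comment> \<open>In units of \<rho>, \<open>t\<close> is a lower bound for the absolute values of
    the nonzero members of \<open>f\<close> plus the integers.\<close>
  define t where "t = (if f = 0 then 1 else min f (1 - f))"
  have t: "t > 0" using f by (auto simp: t_def)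
  have key: "of_int m + f = 0 \<or> t \<le> \<bar>of_int m + f\<bar>" for m :: int
  proof (cases "f = 0")
    case True
    then show ?thesis by (simp add: t_def) linarith
  next
    case False
    then have "t \<le> f" "t \<le> 1 - f" by (auto simp: t_def)
    moreover have "real_of_int m \<ge> 0 \<or> real_of_int m \<le> - 1" by (cases "m \<ge> 0") auto
    ultimately show ?thesis by linarith
  qed
  have "u + \<rho> * of_int i = 0 \<or> \<rho> * t \<le> \<bar>u + \<rho> * of_int i\<bar>" for i :: int
  proof -
    have "u + \<rho> * of_int i = \<rho> * (of_int (\<lfloor>u / \<rho>\<rfloor> + i) + f)"
      by (subst u) (simp add: algebra_simps)
    then show ?thesis using key[of "\<lfloor>u / \<rho>\<rfloor> + i"] assms by (auto simp: abs_mult)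
  qed
  then show ?thesis using t assms by (intro exI[of _ "\<rho> * t"]) auto
qed

lemma has_sum_diff_real:
  fixes f g :: "'b \<Rightarrow> real"
  assumes "(f has_sum x) A" "(g has_sum y) A"
  shows "((\<lambda>z. f z - g z) has_sum (x - y)) A"
  using has_sum_add[OF assms(1) has_sum_uminusI[OF assms(2)]] by simp

context hex_frame
begin

text \<open>This lattice contains the vertices of the cell centred at \<open>z0\<close> as well as
  the centres of all cells, and it is closed under the moves made by
  \<open>vertex_op\<close>.\<close>

definition lattice :: "real \<Rightarrow> real ^ 2 \<Rightarrow> (real ^ 2) set" where
  "lattice \<rho> z0 = {z0 + (\<rho> * of_int i) *\<^sub>R a + (\<rho> * of_int j) *\<^sub>R b | i j :: int. True}"

lemma lattice_base: "z0 \<in> lattice \<rho> z0"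
  unfolding lattice_def by (auto intro!: exI[of _ 0])

lemma lattice_shift:
  assumes "z \<in> lattice \<rho> z0"
  shows "z + (\<rho> * of_int i) *\<^sub>R a + (\<rho> * of_int j) *\<^sub>R b \<in> lattice \<rho> z0"
proof -
  obtain i' j' :: int where "z = z0 + (\<rho> * of_int i') *\<^sub>R a + (\<rho> * of_int j') *\<^sub>R b"
    using assms unfolding lattice_def by blast
  then have "z + (\<rho> * of_int i) *\<^sub>R a + (\<rho> * of_int j) *\<^sub>R b =
      z0 + (\<rho> * of_int (i' + i)) *\<^sub>R a + (\<rho> * of_int (j' + j)) *\<^sub>R b"
    by (simp add: algebra_simps)
  then show ?thesis unfolding lattice_def by blast
qed

text \<open>The coarse and the fine lattice may be in general position to each other. This bound,
  taken for each of them, provides a window around \<open>x0\<close> that isolates it from the other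
  points of both.\<close>

lemma lattice_separated:
  assumes "\<rho> > 0"
  shows "\<exists>\<theta>>0. \<forall>z\<in>lattice \<rho> z0. z = x0 \<or> \<theta> \<le> \<bar>p \<bullet> (z - x0)\<bar> \<or> \<theta> \<le> \<bar>q \<bullet> (z - x0)\<bar>"
proof -
  obtain \<theta>1 where 1: "\<theta>1 > 0"
    "\<And>i :: int. p \<bullet> (z0 - x0) + \<rho> * of_int i = 0 \<or> \<theta>1 \<le> \<bar>p \<bullet> (z0 - x0) + \<rho> * of_int i\<bar>"
    using integer_translates_separated[OF assms] by blast
  obtain \<theta>2 where 2: "\<theta>2 > 0"
    "\<And>i :: int. q \<bullet> (z0 - x0) + \<rho> * of_int i = 0 \<or> \<theta>2 \<le> \<bar>q \<bullet> (z0 - x0) + \<rho> * of_int i\<bar>"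
    using integer_translates_separated[OF assms] by blast
  have "z = x0 \<or> min \<theta>1 \<theta>2 \<le> \<bar>p \<bullet> (z - x0)\<bar> \<or> min \<theta>1 \<theta>2 \<le> \<bar>q \<bullet> (z - x0)\<bar>"
    if z: "z \<in> lattice \<rho> z0" for z
  proof -
    obtain i j :: int where "z = z0 + (\<rho> * of_int i) *\<^sub>R a + (\<rho> * of_int j) *\<^sub>R b"
      using z unfolding lattice_def by blast
    then have pq: "p \<bullet> (z - x0) = p \<bullet> (z0 - x0) + \<rho> * of_int i"
      "q \<bullet> (z - x0) = q \<bullet> (z0 - x0) + \<rho> * of_int j"
      by (simp_all add: frame_simps)
    show ?thesis
    proof (cases "p \<bullet> (z - x0) = 0 \<and> q \<bullet> (z - x0) = 0")
      case True
      then have "z - x0 = 0" by (subst frame_expand[of "z - x0"]) simp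
      then show ?thesis by simp
    next
      case False
      then show ?thesis using 1(2)[of i] 2(2)[of j] unfolding pq by linarith
    qed
  qed
  then show ?thesis using 1(1) 2(1) by (intro exI[of _ "min \<theta>1 \<theta>2"]) auto
qed

lemma vertex_op_scale: "vertex_op \<rho> (\<lambda>z. m * g z) z = m * vertex_op \<rho> g z"
  by (simp add: vertex_op_def algebra_simps)

text \<open>Induction with \<open>step_local\<close>; every iteration costs
  \<open>3 * \<epsilon>\<close> of the window.\<close>

lemma iterate_local:
  assumes "\<epsilon> > 0" "\<rho> > 0" "test_fun \<xi>"
    and \<xi>: "\<And>z x. z \<in> lattice \<rho> z0 \<Longrightarrow> near \<eta> z x \<Longrightarrow> \<xi> x = c z * exp (q \<bullet> (x - z))"
  shows "test_fun (((\<lambda>G. corr (indicator (hexset \<rho>)) (edge_diff \<epsilon> G)) ^^ j) \<xi>) \<and>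
    (\<forall>z\<in>lattice \<rho> z0. \<forall>x. near (\<eta> - 3 * \<epsilon> * real j) z x \<longrightarrow>
      ((\<lambda>G. corr (indicator (hexset \<rho>)) (edge_diff \<epsilon> G)) ^^ j) \<xi> x =
        mass \<epsilon> ^ j * (vertex_op \<rho> ^^ j) c z * exp (q \<bullet> (x - z)))"
proof (induction j)
  case 0
  then show ?case using assms by simp
next
  case (Suc j)
  define G where "G = ((\<lambda>G. corr (indicator (hexset \<rho>)) (edge_diff \<epsilon> G)) ^^ j) \<xi>"
  have nG: "test_fun G" using Suc by (simp add: G_def)
  have G: "G x = (mass \<epsilon> ^ j * (vertex_op \<rho> ^^ j) c z) * exp (q \<bullet> (x - z))"
    if "z \<in> lattice \<rho> z0" "near (\<eta> - 3 * \<epsilon> * real j) z x" for z x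
    using Suc that by (simp add: G_def)
  have n: "test_fun (corr (indicator (hexset \<rho>)) (edge_diff \<epsilon> G))"
    by (intro test_fun_corr test_fun_hexset test_fun_edge_diff nG)
  have "corr (indicator (hexset \<rho>)) (edge_diff \<epsilon> G) x =
      mass \<epsilon> ^ Suc j * (vertex_op \<rho> ^^ Suc j) c z * exp (q \<bullet> (x - z))"
    if "z \<in> lattice \<rho> z0" "near (\<eta> - 3 * \<epsilon> * real (Suc j)) z x" for z x
  proof -
    have "near (\<eta> - 3 * \<epsilon> * real j - 3 * \<epsilon>) z x" using that(2) by (simp add: algebra_simps)
    from step_local[OF assms(1,2) nG lattice_shift G that(1) this]
    show ?thesis by (simp add: vertex_op_scale)
  qed
  then show ?case using n by (simp add: G_def)
qed

lemma edge_diff_commute: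
  assumes "test_fun f" "test_fun h" shows "corr f (edge_diff \<epsilon> h) = edge_diff \<epsilon> (corr f h)"
  unfolding edge_diff_def using assms by (simp add: corr_delta_commute test_fun_delta)

lemma test_fun_edge_diff_funpow: "test_fun h \<Longrightarrow> test_fun ((edge_diff \<epsilon> ^^ k) h)"
  by (induction k) (auto intro: test_fun_edge_diff)

lemma edge_diff_funpow_commute:
  assumes "test_fun f" "test_fun h" shows "corr f ((edge_diff \<epsilon> ^^ k) h) = (edge_diff \<epsilon> ^^ k) (corr f h)"
  using assms by (induction k) (auto simp: edge_diff_commute test_fun_edge_diff_funpow)

text \<open>Correlation operators commute with translations, so \<open>k\<close> differences taken
  in advance can be dealt out, one before each correlation.\<close>

lemma corr_edge_diff_funpow:
  assumes "test_fun f" "test_fun h"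
  shows "(corr f ^^ k) ((edge_diff \<epsilon> ^^ k) h) = ((\<lambda>G. corr f (edge_diff \<epsilon> G)) ^^ k) h"
  using assms(2)
proof (induction k arbitrary: h)
  case (Suc k)
  have "(corr f ^^ Suc k) ((edge_diff \<epsilon> ^^ Suc k) h) = (corr f ^^ k) (corr f ((edge_diff \<epsilon> ^^ k) (edge_diff \<epsilon> h)))"
    by (simp add: funpow_swap1)
  also have "\<dots> = (corr f ^^ k) ((edge_diff \<epsilon> ^^ k) (corr f (edge_diff \<epsilon> h)))"
    using assms(1) Suc.prems by (simp add: edge_diff_funpow_commute test_fun_edge_diff)
  also have "\<dots> = ((\<lambda>G. corr f (edge_diff \<epsilon> G)) ^^ k) (corr f (edge_diff \<epsilon> h))"
    by (intro Suc.IH test_fun_corr test_fun_edge_diff assms(1) Suc.prems)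
  also have "\<dots> = ((\<lambda>G. corr f (edge_diff \<epsilon> G)) ^^ Suc k) h"
    by (simp add: funpow_Suc_right del: funpow.simps)
  finally show ?case .
qed simp

definition bump :: "real \<Rightarrow> real ^ 2 \<Rightarrow> real ^ 2 \<Rightarrow> real" where
  "bump \<eta> x0 x = of_bool (near \<eta> x0 x) * exp (q \<bullet> (x - x0))"

lemma test_fun_bump: "test_fun (bump \<eta> x0)"
proof -
  have b: "bounded {x. near \<eta> x0 x}"
  proof (rule bounded_box)
    fix y assume "y \<in> {x. near \<eta> x0 x}"
    then show "\<bar>p \<bullet> y\<bar> \<le> \<eta> + \<bar>p \<bullet> x0\<bar> + \<bar>q \<bullet> x0\<bar> \<and> \<bar>q \<bullet> y\<bar> \<le> \<eta> + \<bar>p \<bullet> x0\<bar> + \<bar>q \<bullet> x0\<bar>"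
      by (auto simp: near_def frame_simps)
  qed
  then obtain R where R: "\<And>x. near \<eta> x0 x \<Longrightarrow> norm x \<le> R" unfolding bounded_iff by blast
  have m: "{x. near \<eta> x0 x} \<in> sets borel" unfolding near_def by measurable
  have e: "bump \<eta> x0 = (\<lambda>x. indicator {x. near \<eta> x0 x} x * exp (q \<bullet> (x - x0)))"
    by (auto simp: bump_def indicator_def)
  show ?thesis
  proof (rule test_funI)
    show "bump \<eta> x0 \<in> borel_measurable borel" unfolding e using m by measurable
    show "\<bar>bump \<eta> x0 x\<bar> \<le> exp \<eta>" for x by (auto simp: bump_def near_def)
    show "bump \<eta> x0 x = 0" if "norm x > R" for x using R[of x] that by (auto simp: bump_def)
  qed
qed

text \<open>On the windows around lattice points the bump is the weight with amplitude 1 at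
  \<open>x0\<close> and 0 elsewhere, so \<open>iterate_local\<close> computes the pairing as an
  iterate at a point mass.\<close>

lemma corr_hex_spline_bump:
  assumes "\<epsilon> > 0" "\<rho> > 0" "k \<ge> 1" "3 * \<epsilon> * real k < \<eta>"
    and sep: "\<And>z. z \<in> lattice \<rho> z0 \<Longrightarrow> z = x0 \<or> 2 * \<eta> \<le> \<bar>p \<bullet> (z - x0)\<bar> \<or> 2 * \<eta> \<le> \<bar>q \<bullet> (z - x0)\<bar>"
    and z: "z \<in> lattice \<rho> z0"
  shows "corr (conv_power (indicator (hexset \<rho>)) k) ((edge_diff \<epsilon> ^^ k) (bump \<eta> x0)) z =
    mass \<epsilon> ^ k * (vertex_op \<rho> ^^ k) (\<lambda>y. of_bool (y = x0)) z"
proof -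
  have loc: "bump \<eta> x0 x = of_bool (y = x0) * exp (q \<bullet> (x - y))"
    if "y \<in> lattice \<rho> z0" "near \<eta> y x" for x y
  proof (cases "y = x0")
    case True
    then show ?thesis using that by (simp add: bump_def)
  next
    case False
    \<comment> \<open>Windows of radius \<eta> are disjoint once their centres differ by at least
      \<open>2 * \<eta>\<close> in one coordinate.\<close>
    then have "2 * \<eta> \<le> \<bar>p \<bullet> (y - x0)\<bar> \<or> 2 * \<eta> \<le> \<bar>q \<bullet> (y - x0)\<bar>" using sep that by blast
    then have "\<not> near \<eta> x0 x" using that(2) by (auto simp: near_def frame_simps)
    then show ?thesis using False by (simp add: bump_def)
  qed
  have "near (\<eta> - 3 * \<epsilon> * real k) z z" using assms by (simp add: near_def)
  with iterate_local[where ?z0.0 = z0 and \<eta> = \<eta> and c = "\<lambda>y. of_bool (y = x0)" and j = k,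
      OF assms(1,2) test_fun_bump loc] z
  have "((\<lambda>G. corr (indicator (hexset \<rho>)) (edge_diff \<epsilon> G)) ^^ k) (bump \<eta> x0) z =
      mass \<epsilon> ^ k * (vertex_op \<rho> ^^ k) (\<lambda>y. of_bool (y = x0)) z * exp (q \<bullet> (z - z))" by blast
  moreover have "corr (conv_power (indicator (hexset \<rho>)) k) ((edge_diff \<epsilon> ^^ k) (bump \<eta> x0)) =
      ((\<lambda>G. corr (indicator (hexset \<rho>)) (edge_diff \<epsilon> G)) ^^ k) (bump \<eta> x0)"
    unfolding corr_conv_power[OF test_fun_hexset assms(3) test_fun_edge_diff_funpow[OF test_fun_bump]]
    by (rule corr_edge_diff_funpow[OF test_fun_hexset test_fun_bump])
  ultimately show ?thesis by simp
qed

section \<open>Symmetry and factorization of the vertex operator\<close>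

lemma vertex_op_diff: "vertex_op \<rho> (\<lambda>z. f z - g z) z = vertex_op \<rho> f z - vertex_op \<rho> g z"
  and vertex_op_add: "vertex_op \<rho> (\<lambda>z. f z + g z) z = vertex_op \<rho> f z + vertex_op \<rho> g z"
  by (simp_all add: vertex_op_def)

lemma vertex_op_funpow_add: "(vertex_op \<rho> ^^ k) (\<lambda>z. f z + g z) z = (vertex_op \<rho> ^^ k) f z + (vertex_op \<rho> ^^ k) g z"
proof (induction k arbitrary: z)
  case (Suc k)
  then have "(vertex_op \<rho> ^^ k) (\<lambda>z. f z + g z) = (\<lambda>z. (vertex_op \<rho> ^^ k) f z + (vertex_op \<rho> ^^ k) g z)" by blast
  then show ?case by (simp add: vertex_op_add)
qed simp

lemma vertex_op_funpow_diff: "(vertex_op \<rho> ^^ k) (\<lambda>z. f z - g z) z = (vertex_op \<rho> ^^ k) f z - (vertex_op \<rho> ^^ k) g z"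
proof (induction k arbitrary: z)
  case (Suc k)
  then have "(vertex_op \<rho> ^^ k) (\<lambda>z. f z - g z) = (\<lambda>z. (vertex_op \<rho> ^^ k) f z - (vertex_op \<rho> ^^ k) g z)" by blast
  then show ?case by (simp add: vertex_op_diff)
qed simp

text \<open>The signed set of four vertices is invariant under \<open>z \<mapsto> - z\<close>, so
  the operator is its own transpose. The sum over the whole plane has only finitely many nonzero
  terms, as iterates of a point mass have finite support.\<close>

lemma vertex_op_self_adjoint:
  "((\<lambda>z. \<alpha> z * (vertex_op \<rho> ^^ k) (\<lambda>y. of_bool (y = x0)) z) has_sum (vertex_op \<rho> ^^ k) \<alpha> x0) UNIV"
proof (induction k arbitrary: \<alpha>)
  case 0
  have "((\<lambda>z. \<alpha> z * of_bool (z = x0)) has_sum \<alpha> x0) UNIV"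
    using has_sum_finite[of "{x0}" "\<lambda>z. \<alpha> z * of_bool (z = x0)"]
    by (subst has_sum_cong_neutral[where T = "{x0}" and g = "\<lambda>z. \<alpha> z * of_bool (z = x0)"]) auto
  then show ?case by simp
next
  case (Suc k)
  define h where "h = (vertex_op \<rho> ^^ k) (\<lambda>y. of_bool (y = x0))"
  have sh: "((\<lambda>z. \<alpha> z * h (z + w)) has_sum (vertex_op \<rho> ^^ k) (\<lambda>z. \<alpha> (z - w)) x0) UNIV" for w
  proof -
    have "bij_betw (\<lambda>z. z + w) UNIV UNIV" by (rule bij_betwI[where g = "\<lambda>z. z - w"]) auto
    from has_sum_reindex_bij_betw[OF this, of "\<lambda>z. \<alpha> (z - w) * h z"]
    show ?thesis using Suc[of "\<lambda>z. \<alpha> (z - w)"] by (simp add: h_def)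
  qed
  have e: "vertex_op \<rho> \<alpha> = (\<lambda>z. \<alpha> (z - \<rho> *\<^sub>R b) - \<alpha> (z - \<rho> *\<^sub>R (b - a)) + \<alpha> (z - - (\<rho> *\<^sub>R b)) - \<alpha> (z - \<rho> *\<^sub>R (a - b)))"
    by (auto simp: vertex_op_def algebra_simps)
  have "(vertex_op \<rho> ^^ Suc k) \<alpha> x0 = (vertex_op \<rho> ^^ k) (vertex_op \<rho> \<alpha>) x0" by (simp add: funpow_swap1)
  also have "\<dots> = (vertex_op \<rho> ^^ k) (\<lambda>z. \<alpha> (z - \<rho> *\<^sub>R b)) x0 - (vertex_op \<rho> ^^ k) (\<lambda>z. \<alpha> (z - \<rho> *\<^sub>R (b - a))) x0
      + (vertex_op \<rho> ^^ k) (\<lambda>z. \<alpha> (z - - (\<rho> *\<^sub>R b))) x0 - (vertex_op \<rho> ^^ k) (\<lambda>z. \<alpha> (z - \<rho> *\<^sub>R (a - b))) x0"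
    unfolding e vertex_op_funpow_diff vertex_op_funpow_add ..
  finally have r: "(vertex_op \<rho> ^^ Suc k) \<alpha> x0 = \<dots>" .
  have "((\<lambda>z. \<alpha> z * h (z + \<rho> *\<^sub>R b) - \<alpha> z * h (z + \<rho> *\<^sub>R (b - a)) + \<alpha> z * h (z + - (\<rho> *\<^sub>R b))
      - \<alpha> z * h (z + \<rho> *\<^sub>R (a - b))) has_sum (vertex_op \<rho> ^^ Suc k) \<alpha> x0) UNIV"
    unfolding r by (intro has_sum_diff_real has_sum_add sh)
  moreover have "\<alpha> z * (vertex_op \<rho> ^^ Suc k) (\<lambda>y. of_bool (y = x0)) z =
      \<alpha> z * h (z + \<rho> *\<^sub>R b) - \<alpha> z * h (z + \<rho> *\<^sub>R (b - a)) + \<alpha> z * h (z + - (\<rho> *\<^sub>R b))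
      - \<alpha> z * h (z + \<rho> *\<^sub>R (a - b))" for z
    by (simp add: h_def[symmetric] vertex_op_def algebra_simps)
  ultimately show ?case by simp
qed

definition along_op :: "real \<Rightarrow> (real ^ 2 \<Rightarrow> real) \<Rightarrow> real ^ 2 \<Rightarrow> real" where
  "along_op \<rho> g x = g x - g (x + \<rho> *\<^sub>R a)"

definition across_op :: "real \<Rightarrow> (real ^ 2 \<Rightarrow> real) \<Rightarrow> real ^ 2 \<Rightarrow> real" where
  "across_op \<rho> g x = g (x - \<rho> *\<^sub>R b) - g (x - \<rho> *\<^sub>R (a - b))"

text \<open>With X^v for the shift by \<rho> v this is the factorization X^b - X^(b-a) + X^(-b) -
  X^(a-b) = (1 - X^a) (X^(-b) - X^(b-a)).\<close>

lemma vertex_op_factor: "vertex_op \<rho> g = along_op \<rho> (across_op \<rho> g)"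
  by (auto simp: vertex_op_def along_op_def across_op_def algebra_simps)

lemma along_op_across_op_commute: "across_op \<rho> (along_op \<rho> g) = along_op \<rho> (across_op \<rho> g)"
  by (auto simp: along_op_def across_op_def algebra_simps)

lemma vertex_op_funpow_factor: "(vertex_op \<rho> ^^ k) g = (along_op \<rho> ^^ k) ((across_op \<rho> ^^ k) g)"
proof (induction k arbitrary: g)
  case (Suc k)
  have c: "(across_op \<rho> ^^ j) (along_op \<rho> h) = along_op \<rho> ((across_op \<rho> ^^ j) h)" for j h
    by (induction j) (simp_all add: along_op_across_op_commute)
  have "(vertex_op \<rho> ^^ Suc k) g = (vertex_op \<rho> ^^ k) (along_op \<rho> (across_op \<rho> g))"
    by (simp add: funpow_swap1 vertex_op_factor)
  also have "\<dots> = (along_op \<rho> ^^ Suc k) ((across_op \<rho> ^^ Suc k) g)"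
    unfolding Suc by (simp add: funpow_swap1 c)
  finally show ?case .
qed simp

lemma along_op_funpow_bdiff:
  "(along_op \<rho> ^^ k) g (x + (\<rho> * real n) *\<^sub>R a) = (bdiff ^^ k) (\<lambda>n. g (x + (\<rho> * real n) *\<^sub>R a)) n"
proof (induction k arbitrary: n)
  case (Suc k)
  have "x + (\<rho> * real n) *\<^sub>R a + \<rho> *\<^sub>R a = x + (\<rho> * real (Suc n)) *\<^sub>R a"
    by (simp add: algebra_simps)
  note e = this
  have "(along_op \<rho> ^^ Suc k) g y = (along_op \<rho> ^^ k) g y - (along_op \<rho> ^^ k) g (y + \<rho> *\<^sub>R a)" for y
    by (simp add: along_op_def)
  moreover have "(bdiff ^^ Suc k) c n = (bdiff ^^ k) c n - (bdiff ^^ k) c (Suc n)" for c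
    by (simp add: bdiff_def)
  ultimately show ?case by (simp only: e Suc)
qed simp

text \<open>One application moves a point mass by \<open>b\<close> with sign plus and by
  \<open>a - b\<close> with sign minus, changing \<open>q\<close> by 1 and -1. Level
  \<open>k\<close> is therefore the highest, and it is reached only by \<open>k\<close> moves along
  \<open>b\<close>.\<close>

lemma across_op_funpow_point:
  "(q \<bullet> (x - z) > real k \<longrightarrow> (across_op 1 ^^ k) (\<lambda>y. of_bool (y = z)) x = (0 :: real)) \<and>
   (q \<bullet> (x - z) = real k \<longrightarrow> (across_op 1 ^^ k) (\<lambda>y. of_bool (y = z)) x = of_bool (x = z + real k *\<^sub>R b))"
proof (induction k arbitrary: x)
  case (Suc k)
  have q: "q \<bullet> (x - b - z) = q \<bullet> (x - z) - 1" "q \<bullet> (x - (a - b) - z) = q \<bullet> (x - z) + 1"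
    by (simp_all add: frame_simps)
  have "x - b = z + real k *\<^sub>R b \<longleftrightarrow> x = z + real (Suc k) *\<^sub>R b"
    by (auto simp: algebra_simps)
  then show ?case using Suc[of "x - b"] Suc[of "x - (a - b)"] q by (auto simp: across_op_def)
qed auto

text \<open>The highest line that meets the support of the \<open>k\<close>-th iterate at a point mass contains the points
  \<open>z + k b - i a\<close> with \<open>0 \<le> i \<le> k\<close> and signed binomial weights; only the rightmost one has
  \<open>\<sigma> > -1\<close>.\<close>

lemma vertex_op_funpow_point_on_top_edge:
  assumes "\<sigma> > -1"
  shows "(vertex_op 1 ^^ k) (\<lambda>y. of_bool (y = z)) (z + real k *\<^sub>R b + \<sigma> *\<^sub>R a) = of_bool (\<sigma> = 0)"
proof -
  define \<gamma> :: "real ^ 2 \<Rightarrow> real" where "\<gamma> = (across_op 1 ^^ k) (\<lambda>y. of_bool (y = z))"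
  have "(along_op 1 ^^ j) \<gamma> (z + real k *\<^sub>R b + \<sigma> *\<^sub>R a) = of_bool (\<sigma> = 0)" if "\<sigma> > -1" for \<sigma> j
    using that
  proof (induction j arbitrary: \<sigma>)
    case 0
    have "q \<bullet> (z + real k *\<^sub>R b + \<sigma> *\<^sub>R a - z) = real k" by (simp add: frame_simps)
    moreover have "z + real k *\<^sub>R b + \<sigma> *\<^sub>R a = z + real k *\<^sub>R b \<longleftrightarrow> \<sigma> = 0"
      using pa by auto
    ultimately show ?case using across_op_funpow_point[where z = z and k = k and x = "z + real k *\<^sub>R b + \<sigma> *\<^sub>R a"]
      by (simp add: \<gamma>_def)
  next
    case (Suc j)
    have "z + real k *\<^sub>R b + \<sigma> *\<^sub>R a + a = z + real k *\<^sub>R b + (\<sigma> + 1) *\<^sub>R a"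
      by (simp add: algebra_simps)
    note e = this
    have "(along_op 1 ^^ Suc j) \<gamma> (z + real k *\<^sub>R b + \<sigma> *\<^sub>R a) =
        (along_op 1 ^^ j) \<gamma> (z + real k *\<^sub>R b + \<sigma> *\<^sub>R a) - (along_op 1 ^^ j) \<gamma> (z + real k *\<^sub>R b + (\<sigma> + 1) *\<^sub>R a)"
      unfolding e[symmetric] by (simp add: along_op_def)
    \<comment> \<open>The shifted term has offset \<open>\<sigma> + 1\<close> > 0 and vanishes, so
      the value at \<sigma> is unchanged by \<open>along_op\<close>.\<close>
    then show ?case using Suc.IH[of \<sigma>] Suc.IH[of "\<sigma> + 1"] Suc.prems
      by (simp del: funpow.simps)
  qed
  then show ?thesis using assms by (simp add: vertex_op_funpow_factor \<gamma>_def)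
qed

text \<open>The centres of the cells form the index-3 sublattice \<open>i \<equiv> j (mod 3)\<close> of the lattice generated
  by the vertices of a cell.\<close>

definition centers :: "real \<Rightarrow> real ^ 2 \<Rightarrow> (real ^ 2) set" where
  "centers \<rho> w = {w + (\<rho> * of_int i) *\<^sub>R a + (\<rho> * of_int j) *\<^sub>R b | i j :: int. 3 dvd i - j}"

lemma centers_subset_lat: "centers \<rho> w \<subseteq> lattice \<rho> w"
  unfolding centers_def lattice_def by blast

lemma finite_centers_cball:
  assumes "\<rho> > 0" shows "finite (centers \<rho> w \<inter> cball 0 R)"
proof -
  \<comment> \<open>Cauchy-Schwarz with the dual basis bounds the integer coordinates of a centre in
    the ball.\<close>
  define N where "N = \<lceil>(norm p + norm q) * (R + norm w) / \<rho>\<rceil>"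
  have "centers \<rho> w \<inter> cball 0 R \<subseteq>
    (\<lambda>(i, j). w + (\<rho> * of_int i) *\<^sub>R a + (\<rho> * of_int j) *\<^sub>R b) ` ({- N..N} \<times> {- N..N})"
  proof
    fix d assume d: "d \<in> centers \<rho> w \<inter> cball 0 R"
    then obtain i j :: int where ij: "d = w + (\<rho> * of_int i) *\<^sub>R a + (\<rho> * of_int j) *\<^sub>R b"
      unfolding centers_def by blast
    have "norm (d - w) \<le> R + norm w" using d norm_triangle_ineq4[of d w] by simp
    then have "norm p * norm (d - w) \<le> (norm p + norm q) * (R + norm w)"
      "norm q * norm (d - w) \<le> (norm p + norm q) * (R + norm w)"
      by (intro mult_mono; simp)+
    moreover have "p \<bullet> (d - w) = \<rho> * of_int i" "q \<bullet> (d - w) = \<rho> * of_int j"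
      by (simp_all add: ij frame_simps)
    ultimately have "\<bar>\<rho> * of_int i\<bar> \<le> (norm p + norm q) * (R + norm w)"
      "\<bar>\<rho> * of_int j\<bar> \<le> (norm p + norm q) * (R + norm w)"
      using Cauchy_Schwarz_ineq2[of p "d - w"] Cauchy_Schwarz_ineq2[of q "d - w"] by linarith+
    then have "\<bar>real_of_int i\<bar> \<le> (norm p + norm q) * (R + norm w) / \<rho>"
      "\<bar>real_of_int j\<bar> \<le> (norm p + norm q) * (R + norm w) / \<rho>"
      using assms by (simp_all add: abs_mult field_simps)
    then have "\<bar>i\<bar> \<le> N" "\<bar>j\<bar> \<le> N" unfolding N_def by linarith+
    then show "d \<in> (\<lambda>(i, j). w + (\<rho> * of_int i) *\<^sub>R a + (\<rho> * of_int j) *\<^sub>R b) ` ({- N..N} \<times> {- N..N})"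
      using ij by (intro image_eqI[of _ _ "(i, j)"]) auto
  qed
  then show ?thesis by (rule finite_subset) simp
qed

text \<open>A move by \<open>b\<close> changes \<open>i - j\<close> by -1, a move by
  \<open>a - b\<close> changes it by 2. Both are -1 modulo 3, so the support stays within one
  residue class.\<close>

lemma across_op_funpow_support:
  assumes "\<And>z. \<alpha> z \<noteq> 0 \<Longrightarrow> z \<in> centers \<rho> w" and "(across_op \<rho> ^^ k) \<alpha> z \<noteq> 0"
  shows "\<exists>i j :: int. z = w + (\<rho> * of_int i) *\<^sub>R a + (\<rho> * of_int j) *\<^sub>R b \<and> 3 dvd i - j + int k"
  using assms(2)
proof (induction k arbitrary: z)
  case 0
  then show ?case using assms(1)[of z] by (auto simp: centers_def)
next
  case (Suc k)
  have "(across_op \<rho> ^^ Suc k) \<alpha> z = (across_op \<rho> ^^ k) \<alpha> (z - \<rho> *\<^sub>R b) - (across_op \<rho> ^^ k) \<alpha> (z - \<rho> *\<^sub>R (a - b))"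
    by (simp add: across_op_def)
  with Suc.prems consider "(across_op \<rho> ^^ k) \<alpha> (z - \<rho> *\<^sub>R b) \<noteq> 0" | "(across_op \<rho> ^^ k) \<alpha> (z - \<rho> *\<^sub>R (a - b)) \<noteq> 0"
    by force
  then show ?case
  proof cases
    case 1
    from Suc.IH[OF this] obtain i j :: int where
      ij: "z - \<rho> *\<^sub>R b = w + (\<rho> * of_int i) *\<^sub>R a + (\<rho> * of_int j) *\<^sub>R b" "3 dvd i - j + int k" by blast
    have "z = w + (\<rho> * of_int i) *\<^sub>R a + (\<rho> * of_int (j + 1)) *\<^sub>R b"
      using ij(1) by (simp add: algebra_simps)
    moreover have "3 dvd i - (j + 1) + int (Suc k)" using ij(2) by presburger
    ultimately show ?thesis by blast
  next
    case 2
    from Suc.IH[OF this] obtain i j :: int where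
      ij: "z - \<rho> *\<^sub>R (a - b) = w + (\<rho> * of_int i) *\<^sub>R a + (\<rho> * of_int j) *\<^sub>R b" "3 dvd i - j + int k" by blast
    have "z = w + (\<rho> * of_int (i + 1)) *\<^sub>R a + (\<rho> * of_int (j - 1)) *\<^sub>R b"
      using ij(1) by (simp add: algebra_simps)
    moreover have "3 dvd (i + 1) - (j - 1) + int (Suc k)" using ij(2) by presburger
    ultimately show ?thesis by blast
  qed
qed

text \<open>Pairing the relation with the \<open>k\<close>-fold edge difference of a bump at
  \<open>x0\<close> gives an identity between finite sums, up to a common nonzero power of
  \<open>mass\<close>. Self-adjointness then moves the operator from the point mass at
  \<open>x0\<close> to the coefficients. As \<open>x0\<close> is arbitrary, this is an equation
  between functions on the plane.\<close>

lemma refinement_equation: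
  assumes "\<rho> > 0" "k \<ge> 1"
    and ref: "AE x in lborel. ((\<lambda>d. \<alpha> d * conv_power (indicator (hexset \<rho>)) k (x - d)) has_sum
      conv_power (indicator (hexset 1)) k (x - z)) (centers \<rho> w)"
    and supp: "\<And>d. d \<notin> centers \<rho> w \<Longrightarrow> \<alpha> d = 0"
  shows "(vertex_op \<rho> ^^ k) \<alpha> x0 = (vertex_op 1 ^^ k) (\<lambda>y. of_bool (y = z)) x0"
proof -
  obtain \<theta>1 where \<theta>1: "\<theta>1 > 0" "\<And>d. d \<in> lattice \<rho> w \<Longrightarrow> d = x0 \<or> \<theta>1 \<le> \<bar>p \<bullet> (d - x0)\<bar> \<or> \<theta>1 \<le> \<bar>q \<bullet> (d - x0)\<bar>"
    using lattice_separated[OF assms(1)] by blast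
  obtain \<theta>2 where \<theta>2: "\<theta>2 > 0" "\<And>d. d \<in> lattice 1 z \<Longrightarrow> d = x0 \<or> \<theta>2 \<le> \<bar>p \<bullet> (d - x0)\<bar> \<or> \<theta>2 \<le> \<bar>q \<bullet> (d - x0)\<bar>"
    using lattice_separated[OF zero_less_one] by blast
  define \<eta> where "\<eta> = min \<theta>1 \<theta>2 / 2"
  \<comment> \<open>Chosen so that \<open>k\<close> losses of \<open>3 * \<epsilon>\<close> do not
    exhaust the window \<eta>.\<close>
  define \<epsilon> where "\<epsilon> = \<eta> / (3 * real k + 1)"
  have \<eta>: "\<eta> > 0" "2 * \<eta> \<le> \<theta>1" "2 * \<eta> \<le> \<theta>2" using \<theta>1 \<theta>2 by (auto simp: \<eta>_def)
  have \<epsilon>: "\<epsilon> > 0" "3 * \<epsilon> * real k < \<eta>"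
    using \<eta>(1) by (auto simp: \<epsilon>_def field_simps)
  define \<psi> where "\<psi> = (edge_diff \<epsilon> ^^ k) (bump \<eta> x0)"
  have n\<psi>: "test_fun \<psi>" unfolding \<psi>_def by (intro test_fun_edge_diff_funpow test_fun_bump)
  define \<phi> where "\<phi> r = conv_power (indicat_real (hexset r)) k" for r
  have n\<phi>: "test_fun (\<phi> r)" for r unfolding \<phi>_def by (intro test_fun_conv_power test_fun_hexset assms)
  define \<delta> :: "real ^ 2 \<Rightarrow> real" where "\<delta> = (\<lambda>y. of_bool (y = x0))"
  have small: "corr (\<phi> \<rho>) \<psi> d = mass \<epsilon> ^ k * (vertex_op \<rho> ^^ k) \<delta> d" if "d \<in> centers \<rho> w" for d
    unfolding \<phi>_def \<psi>_def \<delta>_def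
    by (rule corr_hex_spline_bump[OF \<epsilon>(1) assms(1,2) \<epsilon>(2)])
       (use \<theta>1(2) \<eta>(2) that centers_subset_lat in \<open>auto dest: order_trans\<close>)
  have big: "corr (\<phi> 1) \<psi> z = mass \<epsilon> ^ k * (vertex_op 1 ^^ k) \<delta> z"
    unfolding \<phi>_def \<psi>_def \<delta>_def
    by (rule corr_hex_spline_bump[OF \<epsilon>(1) zero_less_one assms(2) \<epsilon>(2) _ lattice_base])
       (use \<theta>2(2) \<eta>(3) in \<open>auto dest: order_trans\<close>)
  obtain R where R: "\<And>x. norm x > R \<Longrightarrow> \<psi> x = 0" using test_funE[OF n\<psi>] by metis
  obtain R' where R': "\<And>x. norm x > R' \<Longrightarrow> \<phi> \<rho> x = 0" using test_funE[OF n\<phi>] by metis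
  \<comment> \<open>\<open>R\<close> bounds the support of \<psi> and \<open>R'\<close> that of the
    fine spline; splines centred outside \<open>F\<close> vanish on the support of \<psi>.\<close>
  define F where "F = centers \<rho> w \<inter> cball 0 (R + R')"
  have finF: "finite F" unfolding F_def by (rule finite_centers_cball[OF assms(1)])
  have far: "\<phi> \<rho> (x - d) = 0" if "d \<in> centers \<rho> w - F" "norm x \<le> R" for x d
  proof -
    have "norm d \<le> norm x + norm (x - d)" using norm_triangle_ineq4[of x "x - d"] by simp
    then show ?thesis using that R' by (auto simp: F_def)
  qed
  have int: "integrable lborel (\<lambda>x. \<phi> r (x - d) * \<psi> x)" for r d
    using test_fun_integrable[OF test_fun_mult[OF test_fun_translate[OF n\<phi>[of r], of "- d"] n\<psi>]] by simp
  have corr: "(LINT x|lborel. \<phi> r (x - d) * \<psi> x) = corr (\<phi> r) \<psi> d" for r d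
    unfolding corr_def using lborel_integral_shift[of "\<lambda>x. \<phi> r (x - d) * \<psi> x" d] by simp
  have "corr (\<phi> 1) \<psi> z = (LINT x|lborel. (\<Sum>d\<in>F. \<alpha> d * (\<phi> \<rho> (x - d) * \<psi> x)))"
    unfolding corr[symmetric]
  proof (rule integral_cong_AE)
    show "(\<lambda>x. \<phi> 1 (x - z) * \<psi> x) \<in> borel_measurable lborel" using int by blast
    show "(\<lambda>x. \<Sum>d\<in>F. \<alpha> d * (\<phi> \<rho> (x - d) * \<psi> x)) \<in> borel_measurable lborel"
      by (intro borel_measurable_sum borel_measurable_times[OF borel_measurable_const] borel_measurable_integrable int)
    show "AE x in lborel. \<phi> 1 (x - z) * \<psi> x = (\<Sum>d\<in>F. \<alpha> d * (\<phi> \<rho> (x - d) * \<psi> x))"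
      using ref
    proof eventually_elim
      case (elim x)
      show ?case
      proof (cases "norm x > R")
        case False
        have "((\<lambda>d. \<alpha> d * \<phi> \<rho> (x - d)) has_sum \<phi> 1 (x - z)) F"
          using elim unfolding \<phi>_def[symmetric]
          by (subst (asm) has_sum_cong_neutral[where T = F and g = "\<lambda>d. \<alpha> d * \<phi> \<rho> (x - d)"])
             (use far False in \<open>auto simp: F_def\<close>)
        then have "\<phi> 1 (x - z) = (\<Sum>d\<in>F. \<alpha> d * \<phi> \<rho> (x - d))"
          using has_sum_finite_iff[OF finF] by blast
        then show ?thesis by (simp add: sum_distrib_right mult.assoc)
      qed (simp add: R)
    qed
  qed
  also have "\<dots> = (\<Sum>d\<in>F. \<alpha> d * corr (\<phi> \<rho>) \<psi> d)"
    using int by (simp add: corr)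
  finally have "mass \<epsilon> ^ k * (vertex_op 1 ^^ k) \<delta> z = (\<Sum>d\<in>F. \<alpha> d * (mass \<epsilon> ^ k * (vertex_op \<rho> ^^ k) \<delta> d))"
    using small by (simp add: big F_def)
  also have "\<dots> = mass \<epsilon> ^ k * (\<Sum>d\<in>F. \<alpha> d * (vertex_op \<rho> ^^ k) \<delta> d)"
    by (simp add: sum_distrib_left algebra_simps)
  finally have eq: "(vertex_op 1 ^^ k) \<delta> z = (\<Sum>d\<in>F. \<alpha> d * (vertex_op \<rho> ^^ k) \<delta> d)"
    using mass_nonzero[OF \<epsilon>(1)] by simp
  \<comment> \<open>Needed to cut the sum over the plane in \<open>vertex_op_self_adjoint\<close>
    down to \<open>F\<close>. At a centre outside \<open>F\<close> the pairing is zero, and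
    \<open>small\<close> transfers this to the iterate of the point mass.\<close>
  have out: "\<alpha> d * (vertex_op \<rho> ^^ k) \<delta> d = 0" if "d \<notin> F" for d
  proof (cases "d \<in> centers \<rho> w")
    case True
    have "(\<lambda>x. \<phi> \<rho> (x - d) * \<psi> x) = (\<lambda>_. 0)"
    proof
      fix x show "\<phi> \<rho> (x - d) * \<psi> x = 0"
        using far[of d x] R[of x] True that by (cases "norm x > R") auto
    qed
    then have "corr (\<phi> \<rho>) \<psi> d = 0" unfolding corr[symmetric] by simp
    then show ?thesis using small[OF True] mass_nonzero[OF \<epsilon>(1)] by simp
  qed (simp add: supp)
  have "((\<lambda>d. \<alpha> d * (vertex_op \<rho> ^^ k) \<delta> d) has_sum (vertex_op \<rho> ^^ k) \<alpha> x0) F"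
    using vertex_op_self_adjoint[where \<alpha> = \<alpha> and \<rho> = \<rho> and k = k and ?x0.0 = x0] unfolding \<delta>_def[symmetric]
    by (subst (asm) has_sum_cong_neutral[where T = F and g = "\<lambda>d. \<alpha> d * (vertex_op \<rho> ^^ k) \<delta> d"]) (use out in auto)
  then have 1: "(vertex_op \<rho> ^^ k) \<alpha> x0 = (\<Sum>d\<in>F. \<alpha> d * (vertex_op \<rho> ^^ k) \<delta> d)"
    using has_sum_finite_iff[OF finF] by blast
  have "((\<lambda>d. of_bool (d = z) * (vertex_op 1 ^^ k) \<delta> d) has_sum (vertex_op 1 ^^ k) (\<lambda>y. of_bool (y = z)) x0) {z}"
    using vertex_op_self_adjoint[where \<alpha> = "\<lambda>y. of_bool (y = z)" and \<rho> = 1 and k = k and ?x0.0 = x0] unfolding \<delta>_def[symmetric]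
    by (subst (asm) has_sum_cong_neutral[where T = "{z}" and g = "\<lambda>d. of_bool (d = z) * (vertex_op 1 ^^ k) \<delta> d"]) auto
  then have "(vertex_op 1 ^^ k) (\<lambda>y. of_bool (y = z)) x0 = (vertex_op 1 ^^ k) \<delta> z"
    by (simp add: has_sum_finite_iff)
  then show ?thesis using 1 eq by simp
qed

text \<open>A single coarse hex-spline, the one centred at \<open>z\<close>, already fails to have
  an expansion.\<close>

theorem no_refinement:
  assumes \<rho>: "0 < \<rho>" "\<rho> < 1" and k: "k \<ge> 1"
    and ref: "AE x in lborel. ((\<lambda>d. \<alpha> d * conv_power (indicator (hexset \<rho>)) k (x - d)) has_sum
      conv_power (indicator (hexset 1)) k (x - z)) (centers \<rho> w)"
  shows False
proof -
  define \<alpha>' where "\<alpha>' d = (if d \<in> centers \<rho> w then \<alpha> d else 0)" for d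
  have "AE x in lborel. ((\<lambda>d. \<alpha>' d * conv_power (indicator (hexset \<rho>)) k (x - d)) has_sum
      conv_power (indicator (hexset 1)) k (x - z)) (centers \<rho> w)"
    using ref
  proof eventually_elim
    case (elim x)
    then show ?case
      by (subst has_sum_cong[where g = "\<lambda>d. \<alpha> d * conv_power (indicator (hexset \<rho>)) k (x - d)"])
         (auto simp: \<alpha>'_def)
  qed
  note eq = refinement_equation[OF \<rho>(1) k this]
  have eq: "(vertex_op \<rho> ^^ k) \<alpha>' x = (vertex_op 1 ^^ k) (\<lambda>y. of_bool (y = z)) x" for x
    by (rule eq) (simp add: \<alpha>'_def)
  \<comment> \<open>\<open>x0\<close> lies one fine step before the rightmost point
    \<open>z + real k *\<^sub>R b\<close> of the top line. Index 1 falls on that point; index 0 has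
    offset -\<rho>, which exceeds -1 because \<rho> < 1, and so falls short of the next coarse
    knot.\<close>
  define x0 where "x0 = z + real k *\<^sub>R b + (- \<rho>) *\<^sub>R a"
  define c where "c n = (across_op \<rho> ^^ k) \<alpha>' (x0 + (\<rho> * real n) *\<^sub>R a)" for n
  have c: "(bdiff ^^ k) c n = of_bool (n = 1)" for n
  proof -
    have x: "x0 + (\<rho> * real n) *\<^sub>R a = z + real k *\<^sub>R b + (\<rho> * (real n - 1)) *\<^sub>R a"
      by (simp add: x0_def algebra_simps)
    have "\<rho> * (real n - 1) \<ge> \<rho> * (-1)" using \<rho> by (intro mult_left_mono) auto
    then have gt: "\<rho> * (real n - 1) > -1" using \<rho> by linarith
    have "(bdiff ^^ k) c n = (vertex_op \<rho> ^^ k) \<alpha>' (x0 + (\<rho> * real n) *\<^sub>R a)"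
      unfolding c_def vertex_op_funpow_factor by (rule along_op_funpow_bdiff[symmetric])
    also have "\<dots> = of_bool (n = 1)"
      unfolding eq x vertex_op_funpow_point_on_top_edge[OF gt] using \<rho> by auto
    finally show ?thesis .
  qed
  show False
  proof (rule no_sparse_spline[OF k, of c])
    show "m mod 3 = n mod 3" if nz: "c m \<noteq> 0" "c n \<noteq> 0" for m n
    proof -
      have s: "\<alpha>' d \<noteq> 0 \<Longrightarrow> d \<in> centers \<rho> w" for d by (auto simp: \<alpha>'_def split: if_splits)
      obtain i j :: int where ij: "x0 + (\<rho> * real m) *\<^sub>R a = w + (\<rho> * of_int i) *\<^sub>R a + (\<rho> * of_int j) *\<^sub>R b"
        "3 dvd i - j + int k"
        using across_op_funpow_support[OF s nz(1)[unfolded c_def]] by blast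
      obtain i' j' :: int where ij': "x0 + (\<rho> * real n) *\<^sub>R a = w + (\<rho> * of_int i') *\<^sub>R a + (\<rho> * of_int j') *\<^sub>R b"
        "3 dvd i' - j' + int k"
        using across_op_funpow_support[OF s nz(2)[unfolded c_def]] by blast
      have "p \<bullet> x0 + \<rho> * real m = p \<bullet> w + \<rho> * of_int i" "q \<bullet> x0 = q \<bullet> w + \<rho> * of_int j"
        using arg_cong[OF ij(1), of "(\<bullet>) p"] arg_cong[OF ij(1), of "(\<bullet>) q"] by (simp_all add: frame_simps)
      moreover have "p \<bullet> x0 + \<rho> * real n = p \<bullet> w + \<rho> * of_int i'" "q \<bullet> x0 = q \<bullet> w + \<rho> * of_int j'"
        using arg_cong[OF ij'(1), of "(\<bullet>) p"] arg_cong[OF ij'(1), of "(\<bullet>) q"] by (simp_all add: frame_simps)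
      \<comment> \<open>Both points lie on one line parallel to \<open>a\<close>, so
        \<open>j = j'\<close>, and \<open>m - n\<close> equals \<open>i - i'\<close>, which the two
        divisibility conditions make a multiple of 3.\<close>
      ultimately have "\<rho> * (real m - real n) = \<rho> * (of_int i - of_int i')" "\<rho> * of_int j = \<rho> * of_int j'"
        unfolding right_diff_distrib by linarith+
      then have "real m - real n = of_int i - of_int i'" "j = j'" using \<rho> by auto
      then have "int m - int n = i - i'" "j = j'" by linarith+
      then show ?thesis using ij(2) ij'(2) by presburger
    qed
  qed (simp_all add: c)
qed

end

section \<open>Hexagonal tessellations\<close>

context hex_frame
begin

lemma convex_hexset: "convex (hexset \<rho>)"
proof -
  have "hexset \<rho> = {y. p \<bullet> y \<le> \<rho>} \<inter> {y. p \<bullet> y \<ge> - \<rho>} \<inter> ({y. q \<bullet> y \<le> \<rho>} \<inter> {y. q \<bullet> y \<ge> - \<rho>})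
      \<inter> ({y. (p + q) \<bullet> y \<le> \<rho>} \<inter> {y. (p + q) \<bullet> y \<ge> - \<rho>})"
    by (auto simp: hexset_def inner_add_left)
  then show ?thesis
    by (simp only: convex_Int convex_halfspace_le convex_halfspace_ge)
qed

lemma convex_hull_hexset:
  assumes "\<rho> \<ge> 0"
  shows "convex hull ((*\<^sub>R) \<rho> ` {a, b, b - a, - a, - b, - (b - a)}) = hexset \<rho>"
    (is "convex hull (_ ` ?W) = _")
proof
  let ?V = "(*\<^sub>R) \<rho> ` ?W"
  show "convex hull ?V \<subseteq> hexset \<rho>"
    by (rule hull_minimal) (use assms convex_hexset in \<open>auto simp: hexset_def frame_simps\<close>)
  show "hexset \<rho> \<subseteq> convex hull ?V"
  proof
    fix y assume y: "y \<in> hexset \<rho>"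
    define s u where su: "s = p \<bullet> y" "u = q \<bullet> y"
    have b: "\<bar>s\<bar> \<le> \<rho>" "\<bar>u\<bar> \<le> \<rho>" "\<bar>s + u\<bar> \<le> \<rho>" using y by (auto simp: hexset_def su)
    have e: "y = s *\<^sub>R a + u *\<^sub>R b" unfolding su by (rule frame_expand)
    have V: "v \<in> ?V \<Longrightarrow> v \<in> convex hull ?V" for v by (rule hull_inc)
    have "(1 / 2) *\<^sub>R (\<rho> *\<^sub>R a) + (1 / 2) *\<^sub>R (\<rho> *\<^sub>R (- a)) \<in> convex hull ?V"
      by (rule convexD[OF convex_convex_hull V V]) auto
    then have 0: "0 \<in> convex hull ?V" by simp
    \<comment> \<open>A point of the triangle with corners 0, \<open>\<rho> *\<^sub>R v\<close> and
      \<open>\<rho> *\<^sub>R w\<close>: first a point of the outer side, then its contraction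
      towards 0 by the factor \<open>S\<close>.\<close>
    have tri: "\<alpha> *\<^sub>R v + \<beta> *\<^sub>R w \<in> convex hull ?V"
      if "v \<in> ?W" "w \<in> ?W" "\<alpha> \<ge> 0" "\<beta> \<ge> 0" "\<alpha> + \<beta> \<le> \<rho>" for v w \<alpha> \<beta>
    proof (cases "\<rho> = 0")
      case True
      then have "\<alpha> = 0" "\<beta> = 0" using that by linarith+
      then show ?thesis using 0 by simp
    next
      case False
      then have r: "\<rho> > 0" using assms by simp
      define S where "S = (\<alpha> + \<beta>) / \<rho>"
      have S: "0 \<le> S" "S \<le> 1" using that r by (auto simp: S_def)
      show ?thesis
      proof (cases "\<alpha> + \<beta> = 0")
        case True
        then show ?thesis using that 0 by (simp add: add_nonneg_eq_0_iff)
      next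
        case False
        have "(\<alpha> / (\<alpha> + \<beta>)) *\<^sub>R (\<rho> *\<^sub>R v) + (\<beta> / (\<alpha> + \<beta>)) *\<^sub>R (\<rho> *\<^sub>R w) \<in> convex hull ?V"
          by (rule convexD[OF convex_convex_hull V V]) (use that False in \<open>auto simp: add_divide_distrib[symmetric]\<close>)
        from convexD[OF convex_convex_hull this 0, of S "1 - S"] S
        have "S *\<^sub>R ((\<alpha> / (\<alpha> + \<beta>)) *\<^sub>R (\<rho> *\<^sub>R v) + (\<beta> / (\<alpha> + \<beta>)) *\<^sub>R (\<rho> *\<^sub>R w)) \<in> convex hull ?V"
          by simp
        moreover have "S *\<^sub>R ((\<alpha> / (\<alpha> + \<beta>)) *\<^sub>R (\<rho> *\<^sub>R v) + (\<beta> / (\<alpha> + \<beta>)) *\<^sub>R (\<rho> *\<^sub>R w)) = \<alpha> *\<^sub>R v + \<beta> *\<^sub>R w"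
          using False r by (simp add: S_def scaleR_add_right)
        ultimately show ?thesis by simp
      qed
    qed
    \<comment> \<open>The signs of \<open>s\<close>, \<open>u\<close> and \<open>s + u\<close>
      select one of the six sectors between neighbouring vertices.\<close>
    consider "s \<ge> 0" "u \<ge> 0" | "s \<le> 0" "u \<le> 0" | "s \<le> 0" "u \<ge> 0" "s + u \<ge> 0" | "s \<le> 0" "u \<ge> 0" "s + u \<le> 0"
      | "s \<ge> 0" "u \<le> 0" "s + u \<ge> 0" | "s \<ge> 0" "u \<le> 0" "s + u \<le> 0"
      by linarith
    then show "y \<in> convex hull ?V"
    proof cases
      case 1
      show ?thesis unfolding e by (rule tri) (use 1 b in simp_all)
    next
      case 2
      have "y = (- s) *\<^sub>R (- a) + (- u) *\<^sub>R (- b)" by (simp add: e)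
      moreover have "\<dots> \<in> convex hull ?V" by (rule tri) (use 2 b in simp_all)
      ultimately show ?thesis by simp
    next
      case 3
      have "y = (- s) *\<^sub>R (b - a) + (s + u) *\<^sub>R b" by (simp add: e algebra_simps)
      moreover have "\<dots> \<in> convex hull ?V" by (rule tri) (use 3 b in simp_all)
      ultimately show ?thesis by simp
    next
      case 4
      have "y = u *\<^sub>R (b - a) + (- (s + u)) *\<^sub>R (- a)" by (simp add: e algebra_simps)
      moreover have "\<dots> \<in> convex hull ?V" by (rule tri) (use 4 b in simp_all)
      ultimately show ?thesis by simp
    next
      case 5
      have "y = (- u) *\<^sub>R (- (b - a)) + (s + u) *\<^sub>R a" by (simp add: e algebra_simps)
      moreover have "\<dots> \<in> convex hull ?V" by (rule tri) (use 5 b in simp_all)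
      ultimately show ?thesis by simp
    next
      case 6
      have "y = s *\<^sub>R (- (b - a)) + (- (s + u)) *\<^sub>R (- b)" by (simp add: e algebra_simps)
      moreover have "\<dots> \<in> convex hull ?V" by (rule tri) (use 6 b in simp_all)
      ultimately show ?thesis by simp
    qed
  qed
qed

end

section \<open>Vertices in polar coordinates and the dual basis\<close>

lemma polar_scale: "polar (\<rho> * r) t = \<rho> *\<^sub>R polar r t"
  by (simp add: polar_def vec_eq_iff forall_2)

lemma polar_add_pi: "polar r (t + pi) = - polar r t"
  by (simp add: polar_def vec_eq_iff forall_2)

text \<open>In complex terms, the numbers exp(i pi/3) and exp(-i pi/3) add up to 1.\<close>

lemma polar_add_60: "polar r (u + pi / 3) = polar r u - polar r (u - pi / 3)"
  by (simp add: polar_def vec_eq_iff forall_2 cos_add sin_add cos_diff sin_diff cos_60 sin_60 algebra_simps)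

lemma polar_add_30: "polar r (u - pi / 6) + polar r (u + pi / 6) = polar (r * sqrt 3) u"
  by (simp add: polar_def vec_eq_iff forall_2 cos_add sin_add cos_diff sin_diff cos_30 sin_30 algebra_simps)

lemma polar_directions:
  fixes r t :: real
  defines "a \<equiv> polar r t" and "b \<equiv> polar r (t + pi / 3)"
  shows "polar r (t + 2 * pi / 3) = b - a" "polar r (t + 3 * pi / 3) = - a"
    "polar r (t + 4 * pi / 3) = - b" "polar r (t + 5 * pi / 3) = - (b - a)"
    "polar (r * sqrt 3) (t + pi / 6) = a + b" "polar (r * sqrt 3) (t + pi / 2) = 2 *\<^sub>R b - a"
proof -
  have "t + 2 * pi / 3 = t + pi / 3 + pi / 3" "t + pi / 3 - pi / 3 = t" by simp_all
  then show 2: "polar r (t + 2 * pi / 3) = b - a"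
    using polar_add_60[of r "t + pi / 3"] by (simp only: a_def b_def)
  show "polar r (t + 3 * pi / 3) = - a" using polar_add_pi by (simp add: a_def)
  have "t + 4 * pi / 3 = t + pi / 3 + pi" by simp
  then show "polar r (t + 4 * pi / 3) = - b"
    using polar_add_pi[of r "t + pi / 3"] by (simp only: b_def)
  have "t + 5 * pi / 3 = t + 2 * pi / 3 + pi" by simp
  then show "polar r (t + 5 * pi / 3) = - (b - a)"
    using polar_add_pi[of r "t + 2 * pi / 3"] by (simp only: 2)
  have "t + pi / 6 - pi / 6 = t" "t + pi / 6 + pi / 6 = t + pi / 3" by simp_all
  then show "polar (r * sqrt 3) (t + pi / 6) = a + b"
    using polar_add_30[of r "t + pi / 6"] by (simp only: a_def b_def)
  have "t + pi / 2 - pi / 6 = t + pi / 3" "t + pi / 2 + pi / 6 = t + 2 * pi / 3" by simp_all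
  then have "b + (b - a) = polar (r * sqrt 3) (t + pi / 2)"
    using polar_add_30[of r "t + pi / 2"] by (simp only: 2 b_def[symmetric])
  then show "polar (r * sqrt 3) (t + pi / 2) = 2 *\<^sub>R b - a" by (simp add: scaleR_2)
qed

lemma hex_frame_dual:
  fixes a b :: "real ^ 2"
  assumes "a $ 1 * b $ 2 - a $ 2 * b $ 1 \<noteq> 0"
  shows "\<exists>p q. hex_frame a b p q"
proof -
  define \<Delta> where "\<Delta> = a $ 1 * b $ 2 - a $ 2 * b $ 1"
  \<comment> \<open>Cramer's rule: the coordinates of \<open>x\<close> in the basis
    \<open>a\<close>, \<open>b\<close> are quotients of determinants by \<Delta>.\<close>
  define p :: "real ^ 2" where "p = vector [b $ 2 / \<Delta>, - b $ 1 / \<Delta>]"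
  define q :: "real ^ 2" where "q = vector [- a $ 2 / \<Delta>, a $ 1 / \<Delta>]"
  have \<Delta>: "\<Delta> \<noteq> 0" using assms by (simp add: \<Delta>_def)
  have p: "p \<bullet> x = (x $ 1 * b $ 2 - x $ 2 * b $ 1) / \<Delta>" for x
    by (simp add: p_def inner_vec_def sum_2 diff_divide_distrib mult.commute)
  have q: "q \<bullet> x = (a $ 1 * x $ 2 - a $ 2 * x $ 1) / \<Delta>" for x
    by (simp add: q_def inner_vec_def sum_2 diff_divide_distrib mult.commute)
  have "hex_frame a b p q"
  proof
    show "p \<bullet> a = 1" "q \<bullet> b = 1" "p \<bullet> b = 0" "q \<bullet> a = 0"
      using \<Delta> by (auto simp: p q \<Delta>_def mult.commute)
    fix x :: "real ^ 2"
    have "\<Delta> * x $ i = (x $ 1 * b $ 2 - x $ 2 * b $ 1) * a $ i + (a $ 1 * x $ 2 - a $ 2 * x $ 1) * b $ i" for i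
      using exhaust_2[of i] by (auto simp: \<Delta>_def algebra_simps)
    then have "((x $ 1 * b $ 2 - x $ 2 * b $ 1) * a $ i + (a $ 1 * x $ 2 - a $ 2 * x $ 1) * b $ i) / \<Delta> = x $ i" for i
      using \<Delta> by (metis nonzero_mult_div_cancel_left)
    then show "x = (p \<bullet> x) *\<^sub>R a + (q \<bullet> x) *\<^sub>R b"
      by (simp add: vec_eq_iff p q add_divide_distrib)
  qed
  then show ?thesis by blast
qed

lemma hexagon_vertex_set:
  "{c + polar r (t + real j * pi / 3) | j :: nat. j < 6} =
    (+) c ` {polar r t, polar r (t + pi / 3), polar r (t + 2 * pi / 3), polar r (t + 3 * pi / 3),
      polar r (t + 4 * pi / 3), polar r (t + 5 * pi / 3)}"
proof -
  have "{..<6} = {0, 1, 2, 3, 4, 5 :: nat}" by auto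
  moreover have "{c + polar r (t + real j * pi / 3) | j :: nat. j < 6} =
      (+) c ` (\<lambda>j. polar r (t + real j * pi / 3)) ` {..<6}" by auto
  ultimately show ?thesis by simp
qed

section \<open>Tessellations expressed in a frame\<close>

context hex_frame
begin

text \<open>The generators \<open>a + b\<close> and \<open>2 *\<^sub>R b - a\<close> have
  coordinates (1, 1) and (-1, 2). They span a sublattice of index 3, and \<open>i - j\<close> takes
  on them the values 0 and -3.\<close>

lemma centers_eq:
  "centers \<rho> w = {w + of_int m *\<^sub>R \<rho> *\<^sub>R (a + b) + of_int n *\<^sub>R \<rho> *\<^sub>R (2 *\<^sub>R b - a) | m n :: int. True}"
proof -
  have *: "w + of_int m *\<^sub>R \<rho> *\<^sub>R (a + b) + of_int n *\<^sub>R \<rho> *\<^sub>R (2 *\<^sub>R b - a) =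
      w + (\<rho> * of_int (m - n)) *\<^sub>R a + (\<rho> * of_int (m + 2 * n)) *\<^sub>R b" for m n :: int
    by (simp add: algebra_simps)
  show ?thesis
  proof (intro set_eqI iffI)
    fix x assume "x \<in> centers \<rho> w"
    then obtain i j :: int where ij: "x = w + (\<rho> * of_int i) *\<^sub>R a + (\<rho> * of_int j) *\<^sub>R b" "3 dvd i - j"
      unfolding centers_def by blast
    then obtain n where n: "i - j = 3 * n" by (auto elim: dvdE)
    have "i = (i - n) - (- n)" "j = (i - n) + 2 * (- n)" using n by simp_all
    then have "x = w + of_int (i - n) *\<^sub>R \<rho> *\<^sub>R (a + b) + of_int (- n) *\<^sub>R \<rho> *\<^sub>R (2 *\<^sub>R b - a)"
      unfolding * ij(1) by metis
    then show "x \<in> {w + of_int m *\<^sub>R \<rho> *\<^sub>R (a + b) + of_int n *\<^sub>R \<rho> *\<^sub>R (2 *\<^sub>R b - a) | m n :: int. True}"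
      by blast
  next
    fix x assume "x \<in> {w + of_int m *\<^sub>R \<rho> *\<^sub>R (a + b) + of_int n *\<^sub>R \<rho> *\<^sub>R (2 *\<^sub>R b - a) | m n :: int. True}"
    then obtain m n :: int where "x = w + (\<rho> * of_int (m - n)) *\<^sub>R a + (\<rho> * of_int (m + 2 * n)) *\<^sub>R b"
      unfolding * by blast
    moreover have "3 dvd (m - n) - (m + 2 * n)" by presburger
    ultimately show "x \<in> centers \<rho> w" unfolding centers_def by blast
  qed
qed

lemma countable_centers: "countable (centers \<rho> w)"
proof -
  have "centers \<rho> w \<subseteq> range (\<lambda>(i, j). w + (\<rho> * of_int i) *\<^sub>R a + (\<rho> * of_int j) *\<^sub>R b)"
    unfolding centers_def by auto
  then show ?thesis by (rule countable_subset) simp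
qed

lemma scaled_centers: "(\<lambda>d. \<rho> *\<^sub>R d + v) ` centers 1 w = centers \<rho> (\<rho> *\<^sub>R w + v)"
proof -
  have image: "centers \<sigma> u = (\<lambda>(i, j). u + (\<sigma> * of_int i) *\<^sub>R a + (\<sigma> * of_int j) *\<^sub>R b) ` {(i, j). 3 dvd i - j}"
    for \<sigma> u unfolding centers_def by auto
  have "\<rho> *\<^sub>R (w + (1 * of_int i) *\<^sub>R a + (1 * of_int j) *\<^sub>R b) + v =
      \<rho> *\<^sub>R w + v + (\<rho> * of_int i) *\<^sub>R a + (\<rho> * of_int j) *\<^sub>R b" for i j :: int
    by (simp add: algebra_simps)
  then show ?thesis unfolding image image_image by (intro image_cong) auto
qed

text \<open>Frontiers of convex sets are null sets. The exception made for order 1 thus disappears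
  in an almost-everywhere statement, and all orders are treated alike.\<close>

lemma AE_notin_frontiers:
  assumes "countable T" "\<And>C. C \<in> T \<Longrightarrow> convex C"
  shows "AE x in lborel. x \<notin> cell_boundaries T"
proof -
  have "AE x in lborel. x \<notin> frontier C" if "C \<in> T" for C
  proof (rule AE_not_in)
    have "negligible (frontier C)" using assms that by (intro negligible_convex_frontier) auto
    then show "frontier C \<in> null_sets lborel"
      by (simp add: negligible_iff_null_sets null_sets_completion_iff borel_closed)
  qed
  then show ?thesis
    unfolding cell_boundaries_def using assms(1) by (simp add: AE_ball_countable)
qed

end

lemma not_refinable:
  assumes "hex_frame (polar r t) (polar r (t + pi / 3)) p q"
    and T: "T = {hexagon r t (w + of_int m *\<^sub>R polar (r * sqrt 3) (t + pi / 6)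
                         + of_int n *\<^sub>R polar (r * sqrt 3) (t + pi / 2)) | m n :: int. True}"
    and l: "0 < l" "l < 1" and k: "k \<ge> 1"
  shows "\<not> refinable_on k T (scaled_copy l v T)"
proof
  assume ref: "refinable_on k T (scaled_copy l v T)"
  define a b where ab: "a = polar r t" "b = polar r (t + pi / 3)"
  interpret hex_frame a b p q using assms(1) by (simp add: ab)
  \<comment> \<open>The frame is normalized to the coarse tessellation, so coarse cells have \<rho>
    = 1 and fine cells have \<rho> = \<open>l\<close>.\<close>
  define cell where "cell \<rho> d = (+) d ` hexset \<rho>" for \<rho> d
  have cell: "cell \<rho> d = hexagon (\<rho> * r) t d" if "\<rho> \<ge> 0" for \<rho> d
  proof -
    have "hexagon (\<rho> * r) t d = (+) d ` (convex hull ((*\<^sub>R) \<rho> ` {a, b, b - a, - a, - b, - (b - a)}))"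
      unfolding hexagon_def hexagon_vertex_set convex_hull_translation
      unfolding polar_scale polar_directions ab[symmetric] by (simp add: scaleR_diff_right)
    then show ?thesis unfolding convex_hull_hexset[OF that] cell_def by (rule sym)
  qed
  have center: "cell_center (cell \<rho> d) = d" if "\<rho> \<ge> 0" for \<rho> d
    by (simp only: cell[OF that] cell_center_hexagon)
  have spline: "hex_spline k (cell \<rho> d) x = conv_power (indicator (hexset \<rho>)) k (x - d)"
    if "\<rho> \<ge> 0" for \<rho> d x
    unfolding hex_spline_def center[OF that] by (simp add: cell_def image_image)
  have convex: "convex (cell \<rho> d)" for \<rho> d
    unfolding cell_def by (intro convex_translation convex_hexset)
  have T_eq: "T = cell 1 ` centers 1 w"
    unfolding T centers_eq polar_directions ab[symmetric] using cell[of 1] by auto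
  have "scaled_copy l v T = cell l ` (\<lambda>d. l *\<^sub>R d + v) ` centers 1 w"
  proof -
    have "(\<lambda>x. l *\<^sub>R x + v) ` cell 1 d = cell l (l *\<^sub>R d + v)" for d
    proof -
      have "(\<lambda>x. l *\<^sub>R x) ` hexset 1 = hexset l"
      proof (intro set_eqI iffI)
        fix x assume "x \<in> (\<lambda>x. l *\<^sub>R x) ` hexset 1"
        then obtain y where y: "x = l *\<^sub>R y" "y \<in> hexset 1" by blast
        have "\<bar>l * e\<bar> \<le> l" if "\<bar>e\<bar> \<le> 1" for e
          using that l by (simp add: abs_mult mult_left_le)
        from this[of "p \<bullet> y"] this[of "q \<bullet> y"] this[of "p \<bullet> y + q \<bullet> y"] y(2)
        show "x \<in> hexset l" by (simp add: y(1) hexset_def distrib_left)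
      next
        fix x assume x: "x \<in> hexset l"
        have "\<bar>inverse l * e\<bar> \<le> 1" if "\<bar>e\<bar> \<le> l" for e
          using that l by (simp add: abs_mult field_simps)
        from this[of "p \<bullet> x"] this[of "q \<bullet> x"] this[of "p \<bullet> x + q \<bullet> x"] x
        have "inverse l *\<^sub>R x \<in> hexset 1" by (simp add: hexset_def distrib_left)
        then show "x \<in> (\<lambda>x. l *\<^sub>R x) ` hexset 1"
          using l by (intro image_eqI[of _ _ "inverse l *\<^sub>R x"]) auto
      qed
      then have "cell l (l *\<^sub>R d + v) = (+) (l *\<^sub>R d + v) ` (\<lambda>x. l *\<^sub>R x) ` hexset 1"
        by (simp add: cell_def)
      then show ?thesis by (simp add: cell_def image_image algebra_simps)
    qed
    then show ?thesis by (simp add: scaled_copy_def T_eq image_image)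
  qed
  then have T1_eq: "scaled_copy l v T = cell l ` centers l (l *\<^sub>R w + v)"
    by (simp add: scaled_centers)
  have "w \<in> centers 1 w" unfolding centers_def by (auto intro!: exI[of _ 0])
  then have "cell 1 w \<in> T" by (simp add: T_eq)
  then obtain \<alpha> :: "(real ^ 2) set \<Rightarrow> real" where
    \<alpha>: "\<And>x. (k = 1 \<Longrightarrow> x \<notin> cell_boundaries T \<union> cell_boundaries (scaled_copy l v T)) \<Longrightarrow>
      ((\<lambda>C. \<alpha> C * hex_spline k C x) has_sum hex_spline k (cell 1 w) x) (scaled_copy l v T)"
    using ref unfolding refinable_on_def by blast
  \<comment> \<open>\<open>cell_center\<close> is a left inverse, which allows the sum over cells to
    be reindexed by their centres.\<close>
  have inj: "inj_on (cell l) A" for A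
    by (rule inj_on_inverseI[where g = cell_center]) (use center l in auto)
  have sum: "((\<lambda>d. \<alpha> (cell l d) * conv_power (indicator (hexset l)) k (x - d)) has_sum
      conv_power (indicator (hexset 1)) k (x - w)) (centers l (l *\<^sub>R w + v))"
    if "x \<notin> cell_boundaries T" "x \<notin> cell_boundaries (scaled_copy l v T)" for x
    using \<alpha>[of x] that l unfolding T1_eq has_sum_reindex[OF inj] by (simp add: spline o_def)
  have "AE x in lborel. x \<notin> cell_boundaries T"
    by (rule AE_notin_frontiers) (auto simp: T_eq countable_centers convex)
  moreover have "AE x in lborel. x \<notin> cell_boundaries (scaled_copy l v T)"
    by (rule AE_notin_frontiers) (auto simp: T1_eq countable_centers convex)
  ultimately have "AE x in lborel.
      ((\<lambda>d. \<alpha> (cell l d) * conv_power (indicator (hexset l)) k (x - d)) has_sum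
      conv_power (indicator (hexset 1)) k (x - w)) (centers l (l *\<^sub>R w + v))"
    by eventually_elim (rule sum)
  then show False by (rule no_refinement[OF l k])
qed

theorem corollary1:
  fixes T :: "(real ^ 2) set set" and k :: nat
  assumes "hex_tessellation T" and "k \<ge> 1"
  shows "\<not> (\<exists>l v. 0 < l \<and> l < 1 \<and> refinable_on k T (scaled_copy l v T))"
proof -
  obtain r t w where r: "r > 0" and T: "T = {hexagon r t (w + of_int m *\<^sub>R polar (r * sqrt 3) (t + pi / 6)
                         + of_int n *\<^sub>R polar (r * sqrt 3) (t + pi / 2)) | m n :: int. True}"
    using assms(1) unfolding hex_tessellation_def by blast
  \<comment> \<open>The determinant of two adjacent vertices is \<open>r * r\<close> times the sine
    of 60 degrees, so they form a basis of the plane.\<close>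
  have "polar r t $ 1 * polar r (t + pi / 3) $ 2 - polar r t $ 2 * polar r (t + pi / 3) $ 1 =
      r * r * sin (t + pi / 3 - t)"
    unfolding sin_diff polar_def by (simp add: algebra_simps)
  also have "\<dots> \<noteq> 0" using r by (simp add: sin_60)
  finally obtain p q where "hex_frame (polar r t) (polar r (t + pi / 3)) p q"
    using hex_frame_dual by blast
  from not_refinable[OF this T _ _ assms(2)] show ?thesis by blast
qed

end
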